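(* Let $m\ge 2$ be an integer and let $(\Sigma,\sigma)$ be the one-sided full shift on $m$ symbols with metric $d$. Let $0\le\alpha\le\beta\le\infty$ and $$E_{\alpha,\beta}=\left\{x\in\Sigma: \liminf_{n\to\infty}\frac{\log R_n(x)}{\log n}=\alpha,\ \limsup_{n\to\infty}\frac{\log R_n(x)}{\log n}=\beta\right\}.$$ Then $$\dim_{\rm H}E_{\alpha,\beta}=\begin{cases}1 & \text{if } \alpha\ge 1,\\ 0 & \text{if } \alpha<1.\end{cases}$$
   Context: $\Sigma=\{0,1,\dots,m-1\}^{\mathbb{N}}$ with $\mathbb{N}=\{1,2,\dots\}$, and $\sigma(x)=(x_{i+1})_{i\ge1}$ for $x=(x_i)_{i\ge 1}\in\Sigma$. The metric on $\Sigma$ is $d(x,y)=m^{-\inf\{k\ge 0:\ x_{k+1}\ne y_{k+1}\}}$ (so $d(x,x)=0$). For $n\ge1$ and $x\in\Sigma$ the first return time is $$R_n(x)=\inf\{j\ge 1:\ x_{j+1}x_{j+2}\cdots x_{j+n}=x_1x_2\cdots x_n\},$$ with $\inf\emptyset=\infty$ and $\log\infty=\infty$. $\log$ is the natural logarithm. $\dim_{\rm H}$ denotes Hausdorff dimension with respect to $d$ (the empty set has dimension $0$). *)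

theory Defs
  imports "HOL-Analysis.Analysis"
begin

section \<open>Hausdorff measure and dimension in a metric space\<close>

context Metric_space
begin

definition ediam :: "'a set \<Rightarrow> ennreal" where
  "ediam A = (SUP (x, y)\<in>A \<times> A. ennreal (d x y))"

text \<open>
  The \<open>s\<close>-th power of the diameter, with the usual conventions for the counting case
  \<open>s = 0\<close>: the empty set has weight 0 and every nonempty set has weight 1
  (whereas \<open>0 powr 0 = 0\<close> in HOL). It is only applied to sets of finite diameter.
\<close>
definition diam_power :: "real \<Rightarrow> 'a set \<Rightarrow> ennreal" where
  "diam_power s A =
     (if A = {} then 0 else if s = 0 then 1 else ennreal (enn2real (ediam A) powr s))"

definition hausdorff_premeasure :: "real \<Rightarrow> real \<Rightarrow> 'a set \<Rightarrow> ennreal" where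
  "hausdorff_premeasure s \<delta> E =
     (INF A\<in>{A :: nat \<Rightarrow> 'a set.
              (\<forall>i. A i \<subseteq> M \<and> ediam (A i) \<le> ennreal \<delta>) \<and> E \<subseteq> (\<Union>i. A i)}.
        \<Sum>i. diam_power s (A i))"

definition hausdorff_measure :: "real \<Rightarrow> 'a set \<Rightarrow> ennreal" where
  "hausdorff_measure s E = (SUP \<delta>\<in>{0<..}. hausdorff_premeasure s \<delta> E)"

definition hausdorff_dim :: "'a set \<Rightarrow> ennreal" where
  "hausdorff_dim E = (INF s\<in>{s. 0 \<le> s \<and> hausdorff_measure s E = 0}. ennreal s)"

end

section \<open>The one-sided full shift\<close>

text \<open>
  Sequences are indexed from 0: the symbol \<open>x\<^sub>i\<close> with \<open>i \<ge> 1\<close> is \<open>x (i - 1)\<close>.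
\<close>

definition full_shift :: "nat \<Rightarrow> (nat \<Rightarrow> nat) set" where
  "full_shift m = {x. \<forall>i. x i < m}"

definition shift_dist :: "nat \<Rightarrow> (nat \<Rightarrow> nat) \<Rightarrow> (nat \<Rightarrow> nat) \<Rightarrow> real" where
  "shift_dist m x y = (if x = y then 0 else 1 / real m ^ (LEAST k. x k \<noteq> y k))"

lemma Metric_space_full_shift:
  assumes "m \<ge> 2"
  shows "Metric_space (full_shift m) (shift_dist m)"
proof
  fix x y z :: "nat \<Rightarrow> nat"
  show "0 \<le> shift_dist m x y"
    by (simp add: shift_dist_def)
  show "shift_dist m x y = shift_dist m y x"
    by (simp add: shift_dist_def eq_commute)
  show "shift_dist m x y = 0 \<longleftrightarrow> x = y"
    using assms by (simp add: shift_dist_def)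
  show "shift_dist m x z \<le> shift_dist m x y + shift_dist m y z"
  proof (cases "x = y \<or> y = z \<or> x = z")
    case True
    then show ?thesis by (auto simp: shift_dist_def)
  next
    case False
    define k where "k = (LEAST k. x k \<noteq> z k)"
    from False have "\<exists>k. x k \<noteq> z k" by auto
    then have k: "x k \<noteq> z k" unfolding k_def by (rule LeastI_ex)
    have le: "1 / real m ^ k \<le> 1 / real m ^ j" if "j \<le> k" for j
      using that assms by (intro divide_left_mono power_increasing) auto
    have dxz: "shift_dist m x z = 1 / real m ^ k"
      using False by (simp add: shift_dist_def k_def)
    from k consider "x k \<noteq> y k" | "y k \<noteq> z k" by metis
    then show ?thesis
    proof cases
      case 1
      then have "shift_dist m x z \<le> shift_dist m x y"
        using False le[OF Least_le] dxz by (simp add: shift_dist_def)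
      then show ?thesis by (simp add: shift_dist_def add_increasing2)
    next
      case 2
      then have "shift_dist m x z \<le> shift_dist m y z"
        using False le[OF Least_le] dxz by (simp add: shift_dist_def)
      then show ?thesis by (simp add: shift_dist_def add_increasing)
    qed
  qed
qed

section \<open>First return times\<close>

text \<open>In \<^typ>\<open>enat\<close> the infimum of the empty set is \<open>\<infinity>\<close>.\<close>

definition return_time :: "nat \<Rightarrow> (nat \<Rightarrow> nat) \<Rightarrow> enat" where
  "return_time n x = (INF j\<in>{j. 1 \<le> j \<and> (\<forall>i<n. x (j + i) = x i)}. enat j)"

definition ln_enat :: "enat \<Rightarrow> ereal" where
  "ln_enat r = (case r of enat j \<Rightarrow> ereal (ln (real j)) | \<infinity> \<Rightarrow> \<infinity>)"

definition return_rate :: "(nat \<Rightarrow> nat) \<Rightarrow> nat \<Rightarrow> ereal" where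
  "return_rate x n = ln_enat (return_time n x) / ereal (ln (real n))"

definition return_level_set :: "nat \<Rightarrow> ereal \<Rightarrow> ereal \<Rightarrow> (nat \<Rightarrow> nat) set" where
  "return_level_set m \<alpha> \<beta> =
     {x \<in> full_shift m. liminf (return_rate x) = \<alpha> \<and> limsup (return_rate x) = \<beta>}"

end

theory Submission
  imports Defs "HOL-Probability.Infinite_Product_Measure" "HOL-Real_Asymp.Real_Asymp"
begin

text \<open>
  Upper bounds. Covering by all words of length \<open>n\<close> gives dimension at most 1. If \<open>\<alpha> < 1\<close>, fix
  \<open>\<alpha> < g < 1\<close>. Each point of the level set satisfies \<open>R\<^sub>n < n\<^sup>g\<close> for infinitely many \<open>n\<close>; then its
  prefix of length \<open>n\<close> has a period \<open>j < n\<^sup>g\<close>, so it is determined by \<open>j\<close> symbols. There are at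
  most \<open>n\<^sup>g m\<^bsup>n^g\<^esup>\<close> such prefixes, and against the weights \<open>m\<^bsup>-sn\<^esup>\<close> this is summable for every
  \<open>s > 0\<close>. A Borel--Cantelli argument for Hausdorff measure
  (\<open>hausdorff_measure_limsup_eq_0\<close>) then gives dimension 0.

  Lower bound for \<open>\<alpha> \<ge> 1\<close>. The points constructed consist mostly of free digits, and their
  return times are planted by hand. Choose sparse positions \<open>l\<^sub>k\<close> and copy the prefix of length
  \<open>c\<^sub>k\<close> to position \<open>l\<^sub>k\<close>. If no other long match with the beginning of the word exists, then
  \<open>R\<^sub>n = l\<^sub>k\<close> for, essentially, \<open>c\<^bsub>k-1\<^esub> < n \<le> c\<^sub>k\<close>. Hence the lower limit of \<open>log R\<^sub>n / log n\<close> is that of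
  \<open>log l\<^sub>k / log c\<^sub>k\<close>, and the upper limit is that of \<open>log l\<^bsub>k+1\<^esub> / log c\<^sub>k\<close>. Both can be prescribed
  while keeping \<open>c\<^sub>k\<close> much smaller than \<open>l\<^sub>k\<close>; this is where \<open>\<alpha> \<ge> 1\<close> enters. With \<open>c\<^sub>k = 2\<^bsup>a k\<^esup>\<close> and
  \<open>l\<^sub>k = 2\<^bsup>b k\<^esup>\<close> these ratios are \<open>b k / a k\<close> and \<open>b (k+1) / a k\<close>, see \<open>exists_exponents\<close>.

  Accidental matches are excluded by a few forced digits. The word starts with \<open>p\<close> zeros, while
  beyond these and outside the planted blocks every \<open>p\<close>-th digit is 1; so a match can only start inside a copy.
  The copy at \<open>l\<^sub>k\<close> is followed by a run of ones longer than every run that occurs before \<open>l\<^sub>k\<close>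
  (\<open>ones_run_less\<close>); so a match that starts inside the copy cannot run past this marker
  (\<open>prefix_match_bound\<close>). The forced and planted digits have density at most \<open>3/p\<close>, and a set of
  words whose free digits have density at least \<open>s\<close>, up to a bounded error, has positive \<open>s\<close>-dimensional
  measure by the mass distribution principle (\<open>hausdorff_measure_free_digits_pos\<close>). Letting \<open>p\<close> grow gives dimension 1.
\<close>

section \<open>Distances and diameters in the full shift\<close>

locale shift_space =
  fixes m :: nat
  assumes m_ge_2: "m \<ge> 2"
begin

sublocale Metric_space "full_shift m" "shift_dist m"
  by (rule Metric_space_full_shift[OF m_ge_2])

lemma shift_dist_le:
  assumes "\<And>i. i < k \<Longrightarrow> x i = y i"
  shows "shift_dist m x y \<le> 1 / real m ^ k"
proof (cases "x = y")
  case False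
  then have "\<exists>j. x j \<noteq> y j" by auto
  then have "x (LEAST j. x j \<noteq> y j) \<noteq> y (LEAST j. x j \<noteq> y j)" by (rule LeastI_ex)
  then have "k \<le> (LEAST j. x j \<noteq> y j)" using assms not_less by blast
  then show ?thesis
    using False m_ge_2 by (auto simp: shift_dist_def intro!: divide_left_mono power_increasing)
qed (simp add: shift_dist_def)

lemma shift_dist_ge:
  assumes "x k \<noteq> y k"
  shows "1 / real m ^ k \<le> shift_dist m x y"
proof -
  have "(LEAST j. x j \<noteq> y j) \<le> k" using assms by (rule Least_le)
  moreover have "x \<noteq> y" using assms by auto
  ultimately show ?thesis
    using m_ge_2 by (auto simp: shift_dist_def intro!: divide_left_mono power_increasing)
qed

lemma ediam_le:
  assumes "\<And>x y i. x \<in> A \<Longrightarrow> y \<in> A \<Longrightarrow> i < k \<Longrightarrow> x i = y i"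
  shows "ediam A \<le> ennreal (1 / real m ^ k)"
  unfolding ediam_def
  using assms by (intro SUP_least) (auto intro!: ennreal_leI shift_dist_le)

lemma inverse_power_powr: "(1 / real m ^ n) powr s = real m powr (- s * real n)"
proof -
  have "1 / real m ^ n = real m powr (- real n)"
    using m_ge_2 by (simp add: powr_minus powr_realpow divide_inverse)
  then show ?thesis by (simp add: powr_powr mult.commute)
qed

lemma diam_power_le:
  assumes "s > 0" "ediam A \<le> ennreal (1 / real m ^ n)"
  shows "diam_power s A \<le> ennreal (real m powr (- s * real n))"
proof (cases "A = {}")
  case False
  have "enn2real (ediam A) \<le> 1 / real m ^ n"
    using assms(2) enn2real_mono[OF assms(2)] by simp
  then have "enn2real (ediam A) powr s \<le> (1 / real m ^ n) powr s"
    using assms(1) by (intro powr_mono2) auto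
  then show ?thesis
    unfolding inverse_power_powr using False assms(1)
    by (simp add: diam_power_def ennreal_leI)
qed (simp add: diam_power_def)

lemma exists_power_le:
  assumes "\<delta> > 0"
  shows "\<exists>N. 1 / real m ^ N \<le> \<delta>"
proof -
  have "(\<lambda>N. 1 / real m ^ N) \<longlonglongrightarrow> 0"
    using m_ge_2 LIMSEQ_inverse_realpow_zero[of "real m"] by (simp add: divide_inverse)
  then have "eventually (\<lambda>N. 1 / real m ^ N < \<delta>) sequentially"
    using assms by (rule order_tendstoD)
  then show ?thesis by (auto simp: eventually_sequentially intro: less_imp_le)
qed

end

section \<open>Upper bounds from covers by cylinders\<close>

context shift_space
begin

text \<open>
  Borel--Cantelli for Hausdorff measure: for every \<open>N\<close> the members of the families with index at
  least \<open>N\<close> cover \<open>E\<close>, and their total weight is the tail of a convergent series.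
\<close>
lemma hausdorff_measure_limsup_eq_0:
  fixes W :: "nat \<Rightarrow> (nat \<Rightarrow> nat) set set"
  assumes "s > 0"
    and fin: "\<And>n. finite (W n)"
    and sub: "\<And>n A. A \<in> W n \<Longrightarrow> A \<subseteq> full_shift m"
    and agree: "\<And>n A x y i. A \<in> W n \<Longrightarrow> x \<in> A \<Longrightarrow> y \<in> A \<Longrightarrow> i < n \<Longrightarrow> x i = y i"
    and summ: "summable (\<lambda>n. real (card (W n)) * real m powr (- s * real n))"
    and inf: "\<And>x. x \<in> E \<Longrightarrow> \<exists>\<^sub>F n in sequentially. x \<in> \<Union> (W n)"
  shows "hausdorff_measure s E = 0"
proof -
  let ?c = "\<lambda>n. real (card (W n)) * real m powr (- s * real n)"
  have "hausdorff_premeasure s \<delta> E \<le> 0" if "\<delta> > 0" for \<delta>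
  proof (rule ennreal_le_epsilon)
    fix e :: real assume "e > 0"
    have "(\<lambda>N. \<Sum>n. ?c (n + N)) \<longlonglongrightarrow> 0"
      using suminf_exist_split2[OF summ] .
    then have "eventually (\<lambda>N. (\<Sum>n. ?c (n + N)) < e) sequentially"
      using \<open>e > 0\<close> by (rule order_tendstoD)
    then obtain N1 where N1: "\<And>N. N \<ge> N1 \<Longrightarrow> (\<Sum>n. ?c (n + N)) < e"
      by (auto simp: eventually_sequentially)
    obtain N2 where N2: "1 / real m ^ N2 \<le> \<delta>" using exists_power_le[OF \<open>\<delta> > 0\<close>] by blast
    define N where "N = max N1 N2"
    have "\<exists>f. bij_betw f {..<card (W n)} (W n)" for n
      using ex_bij_betw_nat_finite[OF fin] by (metis atLeast0LessThan)
    then obtain f where f: "\<And>n. bij_betw (f n) {..<card (W n)} (W n)" by metis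
    \<comment> \<open>The members of all \<open>W n\<close> with \<open>n \<ge> N\<close> as a family indexed by pairs, padded with empty sets
      of weight 0; pairing functions turn it into a sequence.\<close>
    define B where "B = (\<lambda>(n, i). if i < card (W (n + N)) then f (n + N) i else {})"
    have B_in: "B (n, i) = {} \<or> B (n, i) \<in> W (n + N)" for n i
      using f[of "n + N"] by (auto simp: B_def bij_betw_def)
    have ediam_B: "ediam (B (n, i)) \<le> ennreal (1 / real m ^ (n + N))" for n i
      by (rule ediam_le) (use B_in[of n i] agree in blast)
    have cover: "(\<forall>t. B (prod_decode t) \<subseteq> full_shift m \<and> ediam (B (prod_decode t)) \<le> ennreal \<delta>)
        \<and> E \<subseteq> (\<Union>t. B (prod_decode t))"
    proof (intro conjI allI subsetI)
      fix t
      obtain n i where ni: "prod_decode t = (n, i)" by fastforce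
      show "x \<in> full_shift m" if "x \<in> B (prod_decode t)" for x
        using B_in[of n i] sub that ni by auto
      have "1 / real m ^ (n + N) \<le> 1 / real m ^ N2"
        using m_ge_2 by (intro divide_left_mono power_increasing) (auto simp: N_def)
      then show "ediam (B (prod_decode t)) \<le> ennreal \<delta>"
        unfolding ni using ediam_B[of n i] N2 by (meson ennreal_leI order_trans)
    next
      fix x assume "x \<in> E"
      then obtain n where "n \<ge> N" "x \<in> \<Union> (W n)"
        using inf[of x] unfolding frequently_sequentially by blast
      then obtain A where "A \<in> W n" "x \<in> A" by blast
      then obtain i where "i < card (W n)" "f n i = A"
        using f[of n] unfolding bij_betw_def by (metis imageE lessThan_iff)
      then have "x \<in> B (prod_decode (prod_encode (n - N, i)))"
        using \<open>n \<ge> N\<close> \<open>x \<in> A\<close> by (simp add: B_def)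
      then show "x \<in> (\<Union>t. B (prod_decode t))" by blast
    qed
    have row: "(\<Sum>i. diam_power s (B (n, i))) \<le> ennreal (?c (n + N))" for n
    proof -
      have "(\<Sum>i. diam_power s (B (n, i))) = (\<Sum>i<card (W (n + N)). diam_power s (B (n, i)))"
        by (rule suminf_finite) (auto simp: B_def diam_power_def)
      also have "\<dots> \<le> (\<Sum>i<card (W (n + N)). ennreal (real m powr (- s * real (n + N))))"
        by (intro sum_mono diam_power_le assms(1) ediam_B)
      also have "\<dots> = ennreal (?c (n + N))"
        by (simp add: ennreal_mult ennreal_of_nat_eq_real_of_nat)
      finally show ?thesis .
    qed
    have "hausdorff_premeasure s \<delta> E \<le> (\<Sum>t. diam_power s (B (prod_decode t)))"
      unfolding hausdorff_premeasure_def
      by (rule INF_lower2[where i = "\<lambda>t. B (prod_decode t)"]) (use cover in auto)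
    also have "\<dots> = (\<Sum>n. \<Sum>i. diam_power s (B (n, i)))"
      by (rule suminf_ennreal_2dimen[of _ "\<lambda>p. diam_power s (B p)"]) simp
    also have "\<dots> \<le> (\<Sum>n. ennreal (?c (n + N)))"
      by (intro suminf_le row) auto
    also have "\<dots> = ennreal (\<Sum>n. ?c (n + N))"
      by (intro suminf_ennreal2 summable_ignore_initial_segment[OF summ]) simp
    also have "\<dots> \<le> ennreal e" using N1[of N] by (intro ennreal_leI) (auto simp: N_def)
    finally show "hausdorff_premeasure s \<delta> E \<le> 0 + ennreal e" by simp
  qed
  then show ?thesis
    unfolding hausdorff_measure_def by (intro antisym SUP_least) auto
qed

definition cylinder :: "nat \<Rightarrow> (nat \<Rightarrow> nat) \<Rightarrow> (nat \<Rightarrow> nat) set" where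
  "cylinder n w = {x \<in> full_shift m. \<forall>i<n. x i = w i}"

text \<open>
  For \<open>s > 1\<close> the \<open>m\<^sup>n\<close> cylinders of length \<open>n\<close> have total weight \<open>m\<^bsup>(1-s)n\<^esup>\<close>, a convergent geometric series.
\<close>
lemma hausdorff_dim_le_1:
  assumes "E \<subseteq> full_shift m"
  shows "hausdorff_dim E \<le> 1"
proof (rule ennreal_le_epsilon)
  fix e :: real assume e: "e > 0"
  define s where "s = 1 + e"
  define words where "words n = PiE {..<n} (\<lambda>_. {..<m})" for n :: nat
  have fin: "finite (words n)" for n by (simp add: words_def finite_PiE)
  have card: "card (cylinder n ` words n) \<le> m ^ n" for n
    using card_image_le[OF fin, of "cylinder n" n] by (simp add: words_def card_PiE)
  have "hausdorff_measure s E = 0"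
  proof (rule hausdorff_measure_limsup_eq_0[where W = "\<lambda>n. cylinder n ` words n"])
    show "summable (\<lambda>n. real (card (cylinder n ` words n)) * real m powr (- s * real n))"
    proof (rule summable_comparison_test')
      have "real m powr (- e) < 1" using m_ge_2 e by (simp add: powr_minus_divide)
      then show "summable (\<lambda>n. (real m powr (- e)) ^ n)" by (intro summable_geometric) auto
      fix n :: nat
      have "real (card (cylinder n ` words n)) * real m powr (- s * real n)
          \<le> real m ^ n * real m powr (- s * real n)"
        using card[of n] by (intro mult_right_mono) (simp_all flip: of_nat_power)
      also have "\<dots> = real m powr (- e * real n)"
        using m_ge_2 by (simp add: s_def powr_realpow[symmetric] powr_add[symmetric] algebra_simps)
      also have "\<dots> = (real m powr (- e)) ^ n"
        using m_ge_2 by (simp add: powr_realpow[symmetric] powr_powr)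
      finally show "norm (real (card (cylinder n ` words n)) * real m powr (- s * real n))
          \<le> (real m powr (- e)) ^ n" by simp
    qed
    fix x assume "x \<in> E"
    have "x \<in> \<Union> (cylinder n ` words n)" for n
    proof -
      have "restrict x {..<n} \<in> words n" "x \<in> cylinder n (restrict x {..<n})"
        using \<open>x \<in> E\<close> assms by (auto simp: words_def cylinder_def full_shift_def)
      then show ?thesis by blast
    qed
    then show "\<exists>\<^sub>F n in sequentially. x \<in> \<Union> (cylinder n ` words n)"
      by simp
  qed (use e fin in \<open>auto simp: s_def cylinder_def\<close>)
  then have "hausdorff_dim E \<le> ennreal s"
    unfolding hausdorff_dim_def using e by (intro INF_lower) (auto simp: s_def)
  then show "hausdorff_dim E \<le> 1 + ennreal e"
    using e by (simp add: s_def)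
qed

end

section \<open>Frequent fast returns have dimension zero\<close>

context shift_space
begin

lemma return_time_less:
  assumes "return_time n x < enat N"
  obtains j where "1 \<le> j" "j < N" "\<And>i. i < n \<Longrightarrow> x (j + i) = x i"
proof -
  have "\<exists>j\<in>{j. 1 \<le> j \<and> (\<forall>i<n. x (j + i) = x i)}. enat j < enat N"
    using assms unfolding return_time_def by (simp add: INF_less_iff)
  then show ?thesis using that by auto
qed

lemma return_time_rate_less:
  assumes "return_rate x n < ereal g" "n \<ge> 2"
  obtains j where "1 \<le> j" "real j < real n powr g" "\<And>i. i < n \<Longrightarrow> x (j + i) = x i"
proof -
  have ln: "ln (real n) > 0" using assms(2) by simp
  obtain N where N: "return_time n x = enat N"
    using assms ln by (cases "return_time n x") (auto simp: return_rate_def ln_enat_def)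
  then obtain j where j: "1 \<le> j" "j < Suc N" "\<And>i. i < n \<Longrightarrow> x (j + i) = x i"
    using return_time_less[of n x "Suc N"] by auto
  have "ln (real N) < g * ln (real n)"
    using assms(1) ln by (simp add: return_rate_def N ln_enat_def field_simps)
  then have "real N < real n powr g"
    using j assms(2) by (simp add: powr_def flip: ln_less_cancel_iff)
  with j that show ?thesis by fastforce
qed

lemma periodic_prefix:
  assumes "1 \<le> (j::nat)" "\<And>i. i < n \<Longrightarrow> x (j + i) = x i" "i < n"
  shows "x i = x (i mod j)"
  using assms(3)
proof (induction i rule: less_induct)
  case (less i)
  show ?case
  proof (cases "i < j")
    case False
    then have "x i = x (i - j)" using assms(2)[of "i - j"] less.prems by simp
    also have "\<dots> = x ((i - j) mod j)" using less False assms(1) by simp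
    finally show ?thesis using False by (simp add: le_mod_geq)
  qed simp
qed

text \<open>
  A return before time \<open>n\<^sup>g\<close> forces a period \<open>j < n\<^sup>g\<close> on the prefix of length \<open>n\<close>, which is then the
  periodic continuation of its first \<open>j\<close> symbols. The number of these continuations is subexponential in
  \<open>n\<close> because \<open>g < 1\<close>.
\<close>
lemma hausdorff_measure_fast_return_eq_0:
  assumes s: "s > 0" and g: "0 < g" "g < 1" and E: "E \<subseteq> full_shift m"
    and fast: "\<And>x. x \<in> E \<Longrightarrow> \<exists>\<^sub>F n in sequentially. return_rate x n < ereal g"
  shows "hausdorff_measure s E = 0"
proof -
  define h where "h n = nat \<lfloor>real n powr g\<rfloor>" for n :: nat
  define words where "words n = (\<Union>j\<in>{1..h n}. (\<lambda>w i. w (i mod j)) ` PiE {..<j} (\<lambda>_. {..<m}))" for n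
  have fin: "finite (words n)" for n
    by (auto simp: words_def intro!: finite_PiE)
  have card: "card (cylinder n ` words n) \<le> h n * m ^ h n" for n
  proof -
    have "card (cylinder n ` words n) \<le> card (words n)" by (rule card_image_le[OF fin])
    also have "\<dots> \<le> (\<Sum>j\<in>{1..h n}. card ((\<lambda>w i. w (i mod j)) ` PiE {..<j} (\<lambda>_. {..<m})))"
      unfolding words_def by (rule card_UN_le) simp
    also have "\<dots> \<le> (\<Sum>j\<in>{1..h n}. m ^ h n)"
    proof (rule sum_mono)
      fix j assume "j \<in> {1..h n}"
      have "card ((\<lambda>w i. w (i mod j)) ` PiE {..<j} (\<lambda>_. {..<m})) \<le> card (PiE {..<j} (\<lambda>_. {..<m}))"
        by (rule card_image_le) (simp add: finite_PiE)
      also have "\<dots> = m ^ j" by (simp add: card_PiE)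
      also have "\<dots> \<le> m ^ h n"
        using \<open>j \<in> {1..h n}\<close> m_ge_2 by (intro power_increasing) auto
      finally show "card ((\<lambda>w i. w (i mod j)) ` PiE {..<j} (\<lambda>_. {..<m})) \<le> m ^ h n" .
    qed
    finally show ?thesis by simp
  qed
  show ?thesis
  proof (rule hausdorff_measure_limsup_eq_0[where W = "\<lambda>n. cylinder n ` words n"])
    let ?u = "\<lambda>n. real n powr g * real m powr (real n powr g) * real m powr (- s * real n)"
    show "summable (\<lambda>n. real (card (cylinder n ` words n)) * real m powr (- s * real n))"
    proof (rule summable_comparison_test_ev)
      have m: "real m > 1" using m_ge_2 by simp
      have "eventually (\<lambda>n. ?u n \<le> 1 / real n ^ 2) sequentially"
        using m s g by real_asymp
      then show "eventually (\<lambda>n. norm (real (card (cylinder n ` words n)) * real m powr (- s * real n))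
                    \<le> 1 / real n ^ 2) sequentially"
      proof eventually_elim
        case (elim n)
        have h: "real (h n) \<le> real n powr g" by (simp add: h_def)
        have "real (card (cylinder n ` words n)) \<le> real (h n) * real m ^ h n"
          using card[of n] by (simp flip: of_nat_mult of_nat_power)
        also have "\<dots> = real (h n) * real m powr real (h n)"
          using m_ge_2 by (simp add: powr_realpow)
        also have "\<dots> \<le> real n powr g * real m powr (real n powr g)"
          using h m_ge_2 by (intro mult_mono powr_mono) auto
        finally have "real (card (cylinder n ` words n)) * real m powr (- s * real n) \<le> ?u n"
          by (rule mult_right_mono) simp
        with elim show ?case by simp
      qed
      show "summable (\<lambda>n. 1 / real n ^ 2)" using inverse_power_summable[of 2] 
        by (simp add: divide_inverse)
    qed
    fix x assume x: "x \<in> E"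
    have "\<exists>\<^sub>F n in sequentially. n \<ge> 2 \<and> return_rate x n < ereal g"
      using fast[OF x] eventually_ge_at_top[of 2] by (rule frequently_eventually_conj)
    then show "\<exists>\<^sub>F n in sequentially. x \<in> \<Union> (cylinder n ` words n)"
    proof (rule frequently_elim1)
      fix n :: nat assume "n \<ge> 2 \<and> return_rate x n < ereal g"
      then obtain j where j: "1 \<le> j" "real j < real n powr g" "\<And>i. i < n \<Longrightarrow> x (j + i) = x i"
        using return_time_rate_less by blast
      have "j \<le> h n" using j(2) by (auto simp: h_def le_nat_iff le_floor_iff)
      have xm: "x i < m" for i using x E by (auto simp: full_shift_def)
      let ?w = "restrict x {..<j}"
      have "(\<lambda>i. ?w (i mod j)) \<in> words n"
        using j(1) \<open>j \<le> h n\<close> xm 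
        unfolding words_def by (intro UN_I[of j] imageI PiE_I) auto
      moreover have "x \<in> cylinder n (\<lambda>i. ?w (i mod j))"
        using periodic_prefix[of j n x, OF j(1) j(3)] j(1) x E by (auto simp: cylinder_def)
      ultimately show "x \<in> \<Union> (cylinder n ` words n)" by blast
    qed
  qed (use s fin in \<open>auto simp: cylinder_def\<close>)
qed

lemma hausdorff_dim_return_level_set_eq_0:
  assumes "0 \<le> \<alpha>" "\<alpha> < 1"
  shows "hausdorff_dim (return_level_set m \<alpha> \<beta>) = 0"
proof -
  obtain g where g: "\<alpha> < ereal g" "ereal g < 1"
    using ereal_dense2[OF assms(2)] by blast
  then have "0 < g" "g < 1" using assms(1) by (auto dest: le_less_trans)
  have "hausdorff_measure s (return_level_set m \<alpha> \<beta>) = 0" if "s > 0" for s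
  proof (rule hausdorff_measure_fast_return_eq_0)
    fix x assume "x \<in> return_level_set m \<alpha> \<beta>"
    then have "liminf (return_rate x) < ereal g" using g by (simp add: return_level_set_def)
    then show "\<exists>\<^sub>F n in sequentially. return_rate x n < ereal g"
      using Liminf_bounded[of "ereal g" "return_rate x" sequentially]
      by (auto simp: frequently_def not_less dest: leD)
  qed (use that \<open>0 < g\<close> \<open>g < 1\<close> in \<open>auto simp: return_level_set_def\<close>)
  then have "hausdorff_dim (return_level_set m \<alpha> \<beta>) \<le> ennreal s" if "s > 0" for s
    unfolding hausdorff_dim_def using that by (intro INF_lower) auto
  then have "hausdorff_dim (return_level_set m \<alpha> \<beta>) \<le> 0 + ennreal e" if "e > 0" for e
    using that by simp
  then have "hausdorff_dim (return_level_set m \<alpha> \<beta>) \<le> 0"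
    by (rule ennreal_le_epsilon)
  then show ?thesis by simp
qed

end

section \<open>Lower bound from a set of free digits\<close>

context shift_space
begin

text \<open>
  Diameters are, up to zero, powers of \<open>1/m\<close>, and a set of diameter \<open>m\<^bsup>-k\<^esup>\<close> lies in a cylinder of length
  \<open>k\<close>. The slack \<open>e\<close> is for singletons, which have weight 0 and are put into a long cylinder.
\<close>
lemma subset_cylinder_diam_power:
  assumes A: "A \<subseteq> full_shift m" "A \<noteq> {}" "ediam A \<le> ennreal 1" and s: "s \<ge> 0" and e: "e > 0"
  shows "\<exists>k w. w \<in> A \<and> A \<subseteq> cylinder k w \<and>
           ennreal (real m powr (- s * real k)) \<le> diam_power s A + ennreal e"
proof -
  obtain w where w: "w \<in> A" using A(2) by blast
  consider "s = 0" | "s > 0" "\<forall>x\<in>A. x = w" | "s > 0" "\<exists>x\<in>A. x \<noteq> w" using s by force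
  then show ?thesis
  proof cases
    case 1
    then have "A \<subseteq> cylinder 0 w" "ennreal (real m powr (- s * real 0)) \<le> diam_power s A + ennreal e"
      using A m_ge_2 by (auto simp: cylinder_def diam_power_def)
    with w show ?thesis by blast
  next
    case 2
    have "(\<lambda>k. real m powr (- s * real k)) \<longlonglongrightarrow> 0"
      using 2(1) m_ge_2 by real_asymp
    then have "eventually (\<lambda>k. real m powr (- s * real k) < e) sequentially"
      using e by (rule order_tendstoD)
    then obtain k where "real m powr (- s * real k) < e"
      by (auto simp: eventually_sequentially)
    then have "ennreal (real m powr (- s * real k)) \<le> 0 + ennreal e" by (simp add: ennreal_leI)
    also have "\<dots> \<le> diam_power s A + ennreal e" by (rule add_right_mono) simp
    finally have "ennreal (real m powr (- s * real k)) \<le> diam_power s A + ennreal e" .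
    moreover have "A \<subseteq> cylinder k w" using 2 A by (auto simp: cylinder_def)
    ultimately show ?thesis using w by blast
  next
    case 3
    define Q where "Q k \<longleftrightarrow> (\<exists>x\<in>A. x k \<noteq> w k)" for k
    define k where "k = (LEAST k. Q k)"
    have "\<exists>k. Q k" using 3(2) by (auto simp: Q_def)
    then have "Q k" unfolding k_def by (rule LeastI_ex)
    then obtain x where x: "x \<in> A" "x k \<noteq> w k" by (auto simp: Q_def)
    have "\<not> Q i" if "i < k" for i using that not_less_Least unfolding k_def by blast
    then have sub: "A \<subseteq> cylinder k w" using A(1) by (auto simp: cylinder_def Q_def)
    have "ennreal (1 / real m ^ k) \<le> ennreal (shift_dist m x w)"
      by (intro ennreal_leI shift_dist_ge x(2))
    also have "\<dots> \<le> ediam A"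
      unfolding ediam_def using x(1) w by (intro SUP_upper2[of "(x, w)"]) auto
    finally have "1 / real m ^ k \<le> enn2real (ediam A)"
      using enn2real_mono[of "ennreal (1 / real m ^ k)" "ediam A"] A(3)
      by (auto simp: le_less_trans[OF _ ennreal_less_top])
    then have "(1 / real m ^ k) powr s \<le> enn2real (ediam A) powr s"
      using s by (intro powr_mono2) auto
    then have "ennreal (real m powr (- s * real k)) \<le> diam_power s A"
      unfolding inverse_power_powr using A(2) 3(1) by (simp add: diam_power_def ennreal_leI)
    also have "\<dots> \<le> diam_power s A + ennreal e" by simp
    finally show ?thesis using w sub by blast
  qed
qed

text \<open>
  Mass distribution principle. Choose \<open>\<omega>\<close> with independent uniform digits. In a cylinder of length \<open>k\<close>
  the point \<open>\<pi> \<omega>\<close> has all its free digits below \<open>k\<close> prescribed, which has probability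
  \<open>m\<^bsup>-card (D \<inter> {..<k})\<^esup>\<close>, at most a constant times \<open>m\<^bsup>-sk\<^esup>\<close>. The events for the members of a cover have
  total probability at least 1, so the total weight of the cover is bounded below.
\<close>
lemma hausdorff_measure_free_digits_pos:
  assumes s: "s \<ge> 0"
    and dens: "\<And>N. s * real N \<le> real (card (D \<inter> {..<N})) + C"
    and into: "\<And>\<omega>. \<omega> \<in> full_shift m \<Longrightarrow> \<pi> \<omega> \<in> E"
    and free: "\<And>\<omega> i. \<omega> \<in> full_shift m \<Longrightarrow> i \<in> D \<Longrightarrow> \<pi> \<omega> i = \<omega> i"
  shows "hausdorff_measure s E \<noteq> 0"
proof
  assume zero: "hausdorff_measure s E = 0"
  \<comment> \<open>A cover of total weight below \<open>c\<close>, enlarged by a total slack of \<open>c\<close>, would have probability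
    at most \<open>m powr C * (c + c) = 1/2\<close>.\<close>
  define c where "c = real m powr (- C) / 4"
  have "c > 0" using m_ge_2 by (simp add: c_def)
  have mC: "real m powr C * c = 1 / 4"
    using m_ge_2 by (simp add: c_def powr_minus)
  have "hausdorff_premeasure s 1 E \<le> hausdorff_measure s E"
    unfolding hausdorff_measure_def by (rule SUP_upper) simp
  also have "\<dots> < ennreal c" using zero \<open>c > 0\<close> by simp
  finally obtain A where A: "\<And>i. A i \<subseteq> full_shift m" "\<And>i. ediam (A i) \<le> ennreal 1"
    "E \<subseteq> (\<Union>i. A i)" and sum: "(\<Sum>i. diam_power s (A i)) < ennreal c"
    unfolding hausdorff_premeasure_def by (auto simp: INF_less_iff)
  have e: "c * (1/2) ^ Suc i > 0" for i using \<open>c > 0\<close> by simp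
  have "\<exists>k w. A i \<noteq> {} \<longrightarrow> w \<in> A i \<and> A i \<subseteq> cylinder k w \<and>
      ennreal (real m powr (- s * real k)) \<le> diam_power s (A i) + ennreal (c * (1/2) ^ Suc i)" for i
    using subset_cylinder_diam_power[OF A(1) _ A(2) s e] by blast
  then obtain k w where kw: "\<And>i. A i \<noteq> {} \<Longrightarrow> w i \<in> A i \<and> A i \<subseteq> cylinder (k i) (w i) \<and>
      ennreal (real m powr (- s * real (k i))) \<le> diam_power s (A i) + ennreal (c * (1/2) ^ Suc i)"
    by metis
  define P where "P = PiM UNIV (\<lambda>_::nat. uniform_count_measure {..<m})"
  have prob: "prob_space (uniform_count_measure {..<m})"
    using m_ge_2 by (intro prob_space_uniform_count_measure) (auto simp: lessThan_empty_iff)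
  interpret U: product_prob_space "\<lambda>_::nat. uniform_count_measure {..<m}" UNIV
    by (intro product_prob_spaceI prob)
  have space_P: "space P = full_shift m"
    by (auto simp: P_def space_PiM space_uniform_count_measure full_shift_def PiE_def Pi_def extensional_def)
  \<comment> \<open>A measurable event that contains the preimage of \<open>A i\<close> under \<open>\<pi>\<close>; the preimage itself may fail to
    be measurable.\<close>
  define B where "B i = (if A i = {} then {} else
      {\<omega> \<in> space P. \<forall>j\<in>D \<inter> {..<k i}. \<omega> j \<in> {w i j}})" for i
  have w_less: "w i j < m" if "A i \<noteq> {}" for i j
    using kw[OF that] A(1)[of i] by (auto simp: full_shift_def)
  have B_sets: "B i \<in> sets P" for i
  proof (cases "A i = {}")
    case False
    have "{\<omega> \<in> space P. \<forall>j\<in>D \<inter> {..<k i}. \<omega> j \<in> {w i j}} \<in> sets P"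
      unfolding P_def using w_less[OF False]
      by (intro sets.sets_Collect_finite_All sets_Collect_single)
        (auto simp: sets_uniform_count_measure)
    then show ?thesis by (simp add: B_def)
  qed (simp add: B_def)
  have cover: "space P \<subseteq> (\<Union>i. B i)"
  proof
    fix \<omega> assume \<omega>: "\<omega> \<in> space P"
    then obtain i where i: "\<pi> \<omega> \<in> A i" using into A(3) space_P by blast
    then have "\<pi> \<omega> j = w i j" if "j < k i" for j
      using kw[of i] that i by (auto simp: cylinder_def)
    then have "\<omega> j = w i j" if "j \<in> D" "j < k i" for j
      using free[of \<omega> j] \<omega> space_P that by simp
    then have "\<omega> \<in> B i" using i \<omega> by (auto simp: B_def)
    then show "\<omega> \<in> (\<Union>i. B i)" by blast
  qed
  have B_le: "emeasure P (B i) \<le> ennreal (real m powr C) * (diam_power s (A i) + ennreal (c * (1/2) ^ Suc i))"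
    for i
  proof (cases "A i = {}")
    case False
    have "emeasure P (B i) = (\<Prod>j\<in>D \<inter> {..<k i}. emeasure (uniform_count_measure {..<m}) {w i j})"
      unfolding B_def P_def using False w_less[OF False]
      by (simp only: if_False, intro U.emeasure_PiM_Collect) (auto simp: sets_uniform_count_measure)
    also have "\<dots> = (\<Prod>j\<in>D \<inter> {..<k i}. ennreal (1 / real m))"
      using w_less[OF False] by (intro prod.cong) (simp_all add: emeasure_uniform_count_measure)
    also have "\<dots> = ennreal ((1 / real m) ^ card (D \<inter> {..<k i}))"
      by (simp add: ennreal_power)
    also have "(1 / real m) ^ card (D \<inter> {..<k i}) = real m powr (- real (card (D \<inter> {..<k i})))"
      using m_ge_2 by (simp add: powr_minus powr_realpow divide_inverse power_inverse)
    also have "ennreal \<dots> \<le> ennreal (real m powr (C + (- s * real (k i))))"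
      using dens[of "k i"] m_ge_2 by (intro ennreal_leI powr_mono) auto
    also have "\<dots> = ennreal (real m powr C) * ennreal (real m powr (- s * real (k i)))"
      by (simp only: powr_add) (simp add: ennreal_mult)
    also have "\<dots> \<le> ennreal (real m powr C) * (diam_power s (A i) + ennreal (c * (1/2) ^ Suc i))"
      using kw[OF False] by (intro mult_left_mono) auto
    finally show ?thesis .
  qed (simp add: B_def)
  have "1 = emeasure P (space P)" unfolding P_def by (rule U.P.emeasure_space_1[symmetric])
  also have "\<dots> \<le> emeasure P (\<Union>i. B i)" using B_sets cover by (intro emeasure_mono) auto
  also have "\<dots> \<le> (\<Sum>i. emeasure P (B i))"
    using B_sets by (intro emeasure_subadditive_countably) auto
  also have "\<dots> \<le> (\<Sum>i. ennreal (real m powr C) * (diam_power s (A i) + ennreal (c * (1/2) ^ Suc i)))"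
    by (intro suminf_le B_le) auto
  also have "\<dots> = ennreal (real m powr C) * ((\<Sum>i. diam_power s (A i)) + (\<Sum>i. ennreal (c * (1/2) ^ Suc i)))"
    by (simp add: suminf_add[symmetric] del: power_Suc)
  also have "(\<Sum>i. ennreal (c * (1/2) ^ Suc i)) = ennreal c"
  proof (rule suminf_ennreal_eq)
    show "(\<lambda>i. c * (1/2) ^ Suc i) sums c"
      using sums_mult[OF power_half_series, of c] by simp
  qed (use \<open>c > 0\<close> in auto)
  also have "ennreal (real m powr C) * ((\<Sum>i. diam_power s (A i)) + ennreal c)
      \<le> ennreal (real m powr C) * (ennreal c + ennreal c)"
    using sum by (intro mult_left_mono add_right_mono) auto
  also have "\<dots> = ennreal (real m powr C * (c + c))"
    using \<open>c > 0\<close> by (simp add: ennreal_mult flip: ennreal_plus)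
  also have "real m powr C * (c + c) = 1 / 2" using mC by (simp only: distrib_left)
  also have "ennreal (1 / 2) < ennreal 1" by (simp only: ennreal_less_iff)
  finally show False by simp
qed

end

section \<open>Insertion of prefixes at sparse positions\<close>

text \<open>
  The prefix of length \<open>c k\<close> is copied to position \<open>l k\<close>. That \<open>p\<close> divides \<open>l k\<close> makes the position just
  before a copy one where the digit 1 is forced, so that a copy cannot prolong a run of zeros to the left. The
  factor \<open>2 ^ Suc k\<close> makes the blocks before position \<open>N\<close> have total length at most \<open>N / p\<close>.
\<close>
locale prefix_insertion =
  fixes p :: nat and c l :: "nat \<Rightarrow> nat"
  assumes p_ge_3: "p \<ge> 3"
    and c_pos: "c k > 0"
    and p_dvd_l: "p dvd l k"
    and l_double: "2 * l k \<le> l (Suc k)"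
    and sparse: "p * 2 ^ Suc k * (c k + k + p + 4) \<le> l k"
begin

text \<open>
  A copy of length \<open>c k\<close>, followed by the marker: 0, then \<open>k + p + 1\<close> ones, then 0 and 1. The zeros
  isolate the run of ones; the last 1 prevents the zero before it from starting a run of \<open>p\<close> zeros.
\<close>
definition block :: "nat \<Rightarrow> nat set" where
  "block k = {l k..<l k + c k + k + p + 4}"

definition free :: "nat set" where
  "free = {i. p < i \<and> (\<forall>k. i \<notin> block k) \<and> i mod p \<noteq> p - 2 \<and> i mod p \<noteq> p - 1}"

lemma sparse': "c k + k + p + 4 < l k" "p < l k"
proof -
  have "2 * (c k + k + p + 4) \<le> p * 2 ^ Suc k * (c k + k + p + 4)"
    using p_ge_3 one_le_power[of "2::nat" k] by (intro mult_right_mono) (auto intro: order_trans[of _ "p * 1"] simp: mult_mono)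
  then have "2 * (c k + k + p + 4) \<le> l k" using sparse[of k] by (rule order_trans)
  then show "c k + k + p + 4 < l k" by simp
  then show "p < l k" by simp
qed

lemma l_strict_mono: "strict_mono l"
  using l_double sparse'(2) unfolding strict_mono_Suc_iff
  by (metis add_strict_left_mono add_0_right less_le_trans mult_2 not_less0 not_gr_zero)

lemma block_end_less:
  assumes "j < k"
  shows "l j + c j + j + p + 4 < l k"
proof -
  have "l (Suc j) \<le> l k" using assms l_strict_mono by (simp add: strict_mono_less_eq)
  then show ?thesis using l_double[of j] sparse'(1)[of j] by linarith
qed

lemma block_unique:
  assumes "i \<in> block j" "i \<in> block k"
  shows "j = k"
  using assms block_end_less[of j k] block_end_less[of k j]
  by (cases j k rule: linorder_cases) (auto simp: block_def)

text \<open>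
  The word obtained from \<open>\<omega>\<close> by overwriting the digits outside \<open>free\<close>. A copy refers to digits further to
  the left, so the recursion ends. The prefix is \<open>p\<close> zeros and a 1; outside the blocks, residue \<open>p - 2\<close>
  interrupts runs of ones and residue \<open>p - 1\<close> interrupts runs of zeros.
\<close>
function inserted :: "(nat \<Rightarrow> nat) \<Rightarrow> nat \<Rightarrow> nat" where
  "inserted \<omega> i =
    (if i < p then 0
     else if i = p then 1
     else if \<exists>k. i \<in> block k then
       (let k = THE k. i \<in> block k in
          if i < l k + c k then inserted \<omega> (i - l k)
          else if i = l k + c k \<or> i = l k + c k + k + p + 2 then 0
          else 1)
     else if i mod p = p - 2 then 0
     else if i mod p = p - 1 then 1
     else \<omega> i)"
  by pat_completeness auto
termination
  using sparse'(2) p_ge_3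
  by (relation "Wellfounded.measure snd") (auto intro!: diff_less, metis gr0I not_less0)

declare inserted.simps [simp del]

lemma inserted_prefix: "i < p \<Longrightarrow> inserted \<omega> i = 0"
  by (simp add: inserted.simps)

lemma inserted_p: "inserted \<omega> p = 1"
  by (simp add: inserted.simps)

lemma inserted_block:
  assumes "i \<in> block k"
  shows "inserted \<omega> i = (if i < l k + c k then inserted \<omega> (i - l k)
     else if i = l k + c k \<or> i = l k + c k + k + p + 2 then 0 else 1)"
proof -
  have "(THE k. i \<in> block k) = k" using assms block_unique by blast
  moreover have "\<not> i < p" "i \<noteq> p" using assms sparse'(2)[of k] by (simp_all add: block_def)
  moreover have "\<exists>k. i \<in> block k" using assms by blast
  ultimately show ?thesis by (subst inserted.simps) (simp only: Let_def if_True if_False simp_thms)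
qed

lemma inserted_copy: "j < c k \<Longrightarrow> inserted \<omega> (l k + j) = inserted \<omega> j"
  by (subst inserted_block[of _ k]) (auto simp: block_def)

lemma inserted_marker:
  shows "inserted \<omega> (l k + c k) = 0"
    and "j < k + p + 1 \<Longrightarrow> inserted \<omega> (l k + c k + 1 + j) = 1"
    and "inserted \<omega> (l k + c k + k + p + 2) = 0"
    and "inserted \<omega> (l k + c k + k + p + 3) = 1"
  by (subst inserted_block[of _ k]; simp add: block_def)+

lemma inserted_outside:
  assumes "p < i" "\<And>k. i \<notin> block k"
  shows "i mod p = p - 2 \<Longrightarrow> inserted \<omega> i = 0" "i mod p = p - 1 \<Longrightarrow> inserted \<omega> i = 1"
  using assms p_ge_3 by (auto simp: inserted.simps)

lemma inserted_free: "i \<in> free \<Longrightarrow> inserted \<omega> i = \<omega> i"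
  by (subst inserted.simps) (auto simp: free_def)

lemma inserted_less:
  assumes "\<And>i. \<omega> i < m" "2 \<le> m"
  shows "inserted \<omega> i < m"
  using assms
proof (induction i rule: less_induct)
  case (less i)
  show ?case
  proof (cases "\<exists>k. i \<in> block k")
    case True
    then obtain k where k: "i \<in> block k" by blast
    then have "i - l k < i" using sparse'(2)[of k] by (auto simp: block_def)
    then have "inserted \<omega> (i - l k) < m" using less by blast
    then show ?thesis using less.prems(2) by (simp add: inserted_block[OF k])
  next
    case False
    then show ?thesis using less.prems by (subst inserted.simps) simp
  qed
qed

text \<open>
  This makes the forced digits effective: beyond the prefix, a window of length \<open>p\<close> that avoids all blocks
  contains both a forced 0 and a forced 1.
\<close>
lemma window_residue:
  assumes "r < p"
  obtains t where "i \<le> t" "t < i + p" "t mod p = r"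
proof -
  define j where "j = (r + (p - i mod p)) mod p"
  have "(i + j) mod p = (i mod p + (r + (p - i mod p))) mod p"
    by (simp add: j_def mod_simps)
  also have "i mod p + (r + (p - i mod p)) = r + p"
    using mod_less_divisor[of p i] assms by linarith
  finally have "(i + j) mod p = r" using assms by simp
  moreover have "j < p" using assms by (simp add: j_def)
  ultimately show ?thesis using that[of "i + j"] by simp
qed

text \<open>
  A run of ones of length greater than \<open>p\<close> contains a position with residue \<open>p - 2\<close>, which must lie in a block
  \<open>h < k\<close>. Such a block contains zeros at the start of the copy and on both sides of the run in the marker.
  So the run lies either in the marker, where it is short since \<open>h < k\<close>, or inside the copy, where it
  reproduces a run further to the left.
\<close>
lemma ones_run_less:
  assumes "\<And>j. j < r \<Longrightarrow> inserted \<omega> (i + j) = 1" "i + r \<le> l k"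
  shows "r < k + p + 1"
  using assms
proof (induction i rule: less_induct)
  case (less i)
  have one: "inserted \<omega> s = 1" if "i \<le> s" "s < i + r" for s
    using less.prems(1)[of "s - i"] that by simp
  show ?case
  proof (rule ccontr)
    assume "\<not> r < k + p + 1"
    then have r: "k + p + 1 \<le> r" by simp
    \<comment> \<open>The window starts at \<open>Suc i\<close> since \<open>i\<close> may be the final 1 of a block; the run has length at least
      \<open>p + 1\<close> and covers this window.\<close>
    obtain t where "Suc i \<le> t" "t < Suc i + p" and "t mod p = p - 2"
      by (rule window_residue[of "p - 2" "Suc i"]) (use p_ge_3 in simp)
    then have t: "i < t" "t \<le> i + p" "t mod p = p - 2" by auto
    have xt: "inserted \<omega> t = 1" using one t r by simp
    have "p < t"
      using xt t(3) inserted_prefix[of t \<omega>] p_ge_3 by (cases t p rule: linorder_cases) auto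
    then obtain h where h: "t \<in> block h" using xt t(3) inserted_outside(1)[of t \<omega>] by auto
    have "h < k"
      using h t less.prems(2) r block_end_less[of k h]
      by (cases h k rule: linorder_cases) (auto simp: block_def)
    have zeros: "inserted \<omega> (l h) = 0" "inserted \<omega> (l h + c h) = 0"
        "inserted \<omega> (l h + c h + h + p + 2) = 0"
      using inserted_copy[of 0 h \<omega>] c_pos[of h] inserted_prefix[of 0 \<omega>] p_ge_3
        inserted_marker(1,3)[of \<omega> h] by simp_all
    then have avoid: "\<not> (i \<le> s \<and> s < i + r)"
      if "s \<in> {l h, l h + c h, l h + c h + h + p + 2}" for s
      using one[of s] that by auto
    have "l h < i" using avoid[of "l h"] h t r by (auto simp: block_def)
    show False
    proof (cases "t < l h + c h")
      case True
      then have "i + r \<le> l h + c h" using avoid[of "l h + c h"] t by auto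
      have "r < k + p + 1"
      proof (rule less.IH)
        show "i - l h < i" using \<open>l h < i\<close> sparse'(2)[of h] by simp
        show "inserted \<omega> (i - l h + j) = 1" if "j < r" for j
          using inserted_copy[of "i - l h + j" h \<omega>] less.prems(1)[OF that] that \<open>l h < i\<close>
            \<open>i + r \<le> l h + c h\<close> by simp
        show "i - l h + r \<le> l k" using less.prems(2) by simp
      qed
      with r show False by simp
    next
      case False
      then have "l h + c h < i" using avoid[of "l h + c h"] t r by auto
      have "t \<noteq> l h + c h + h + p + 2" using avoid[of t] t r by auto
      have "i + r \<le> l h + c h + h + p + 2"
        using avoid[of "l h + c h + h + p + 2"] h t(1) by (auto simp: block_def)
      then show False using \<open>l h + c h < i\<close> \<open>h < k\<close> r by simp
    qed
  qed
qed

text \<open>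
  A match of length greater than \<open>p\<close> starts with \<open>p\<close> zeros, so it begins inside a copy, say the one at \<open>l k\<close>;
  the starts \<open>i \<le> p\<close> are excluded because a match would put one of these zeros on the 1 at position \<open>p\<close>.
  If it were longer than stated, it would cover the marker of that copy; the prefix would then contain a run of
  \<open>k + p + 1\<close> ones before position \<open>l k\<close>, against \<open>ones_run_less\<close>.
\<close>
lemma prefix_match_bound:
  assumes "i \<ge> 1" "L > p" and match: "\<And>j. j < L \<Longrightarrow> inserted \<omega> (i + j) = inserted \<omega> j"
  obtains k where "l k \<le> i" "L \<le> c k + k + p + 2"
proof -
  let ?x = "inserted \<omega>"
  have zero: "?x t = 0" if "i \<le> t" "t < i + p" for t
    using match[of "t - i"] that assms(2) inserted_prefix[of "t - i" \<omega>] by simp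
  have "p < i"
    using zero[of p] assms(1) inserted_p[of \<omega>] by (cases "i \<le> p") auto
  obtain t where t: "i \<le> t" "t < i + p" "t mod p = p - 1"
    using window_residue[of "p - 1" i] p_ge_3 by auto
  then obtain h where h: "t \<in> block h"
    using zero[of t] \<open>p < i\<close> inserted_outside(2)[of t \<omega>] by auto
  have "l h \<le> i"
  proof (rule ccontr)
    assume "\<not> l h \<le> i"
    then have *: "i \<le> l h - 1" "l h - 1 < i + p"
      using h t by (auto simp: block_def)
    have "l h - 1 \<notin> block g" for g
      using block_end_less[of g h] block_end_less[of h g] * \<open>p < i\<close>
      by (cases g h rule: linorder_cases) (auto simp: block_def)
    moreover have "(l h - 1) mod p = p - 1"
    proof -
      obtain d where d: "l h = p * Suc d"
        using p_dvd_l[of h] sparse'(2)[of h] by (metis dvd_def mult_0_right not0_implies_Suc not_less0)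
      then have "l h - 1 = (p - 1) + p * d" using p_ge_3 by simp
      then have "(l h - 1) mod p = (p - 1) mod p" by (simp only: mod_mult_self2)
      then show ?thesis using p_ge_3 by simp
    qed
    ultimately have "?x (l h - 1) = 1"
      using * \<open>p < i\<close> by (intro inserted_outside) auto
    with zero * show False by simp
  qed
  moreover have "i < l h + c h"
  proof (rule ccontr)
    assume "\<not> i < l h + c h"
    moreover have "i < l h + c h + h + p + 4" using h t by (simp add: block_def)
    ultimately have "i = l h + c h \<or> i - (l h + c h + 1) < h + p + 1
        \<and> i = l h + c h + 1 + (i - (l h + c h + 1))
      \<or> i = l h + c h + h + p + 2 \<or> i = l h + c h + h + p + 3"
      by linarith
    then have "?x i = 1 \<or> ?x (i + 1) = 1"
    proof (elim disjE conjE)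
      assume "i = l h + c h"
      then show ?thesis using inserted_marker(2)[of 0 h \<omega>] by simp
    next
      assume "i - (l h + c h + 1) < h + p + 1" "i = l h + c h + 1 + (i - (l h + c h + 1))"
      then show ?thesis using inserted_marker(2)[of "i - (l h + c h + 1)" h \<omega>] by simp
    next
      assume "i = l h + c h + h + p + 2"
      then have "i + 1 = l h + c h + h + p + 3" by simp
      then show ?thesis by (simp only: inserted_marker(4) simp_thms)
    next
      assume "i = l h + c h + h + p + 3"
      then show ?thesis by (simp only: inserted_marker(4) simp_thms)
    qed
    then show False using zero[of i] zero[of "i + 1"] p_ge_3 by auto
  qed
  moreover have "L \<le> c h + h + p + 2"
  proof (rule ccontr)
    assume L: "\<not> L \<le> c h + h + p + 2"
    \<comment> \<open>The position in the prefix to which the match carries the first 1 of the marker.\<close>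
    define a where "a = c h - (i - l h) + 1"
    \<comment> \<open>The absurd bound for the run of ones that the match produces at \<open>a\<close>.\<close>
    have "h + p + 1 < h + p + 1"
    proof (rule ones_run_less)
      show "a + (h + p + 1) \<le> l h" using sparse'(1)[of h] by (simp add: a_def)
      fix j assume j: "j < h + p + 1"
      have "?x (a + j) = ?x (i + (a + j))" using match[of "a + j"] L j by (simp add: a_def)
      also have "i + (a + j) = l h + c h + 1 + j"
        using \<open>l h \<le> i\<close> \<open>i < l h + c h\<close> by (simp add: a_def)
      finally show "?x (a + j) = 1" using inserted_marker(2)[OF j] by simp
    qed
    then show False by simp
  qed
  ultimately show ?thesis using that by blast
qed

lemma return_time_inserted_ge:
  assumes "p < n" "\<And>k. k < K \<Longrightarrow> c k + k + p + 2 < n"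
  shows "enat (l K) \<le> return_time n (inserted \<omega>)"
  unfolding return_time_def
proof (rule INF_greatest)
  fix j assume "j \<in> {j. 1 \<le> j \<and> (\<forall>i<n. inserted \<omega> (j + i) = inserted \<omega> i)}"
  then obtain k where k: "l k \<le> j" "n \<le> c k + k + p + 2"
    using prefix_match_bound[of j n \<omega>] assms(1) by auto
  then have "K \<le> k" using assms(2)[of k] by linarith
  then have "l K \<le> l k" using l_strict_mono by (simp add: strict_mono_less_eq)
  with k show "enat (l K) \<le> enat j" by simp
qed

lemma return_time_inserted_le:
  assumes "n \<le> c k"
  shows "return_time n (inserted \<omega>) \<le> enat (l k)"
  unfolding return_time_def
  using assms sparse'(2)[of k] inserted_copy[of _ k \<omega>] by (intro INF_lower) auto

lemma card_residue_le: "card {i. i < N \<and> i mod p = r} \<le> N div p + 1"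
proof -
  have "inj_on (\<lambda>i. i div p) {i. i < N \<and> i mod p = r}"
    by (intro inj_onI) (metis (mono_tags, lifting) div_mod_decomp mem_Collect_eq)
  then have "card {i. i < N \<and> i mod p = r} = card ((\<lambda>i. i div p) ` {i. i < N \<and> i mod p = r})"
    by (simp add: card_image)
  also have "\<dots> \<le> card {..N div p}"
    by (intro card_mono) (auto intro: div_le_mono)
  finally show ?thesis by simp
qed

text \<open>
  Each of the two forced residues, and also the union of all blocks, takes up at most a share \<open>1/p\<close> of the
  positions below \<open>N\<close>, up to a bounded error.
\<close>
lemma card_free_ge:
  "(1 - 3 / real p) * real N \<le> real (card (free \<inter> {..<N})) + (real p + 3)"
proof -
  have k_less: "k < l k" for k using l_strict_mono sparse'(1)[of k] by simp
  let ?R = "\<lambda>r. {i. i < N \<and> i mod p = r}"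
  let ?B = "\<Union>k\<in>{k. k < N \<and> l k < N}. block k"
  have "{..<N} \<subseteq> (free \<inter> {..<N}) \<union> {..p} \<union> ?R (p - 2) \<union> ?R (p - 1) \<union> ?B"
  proof
    fix i assume i: "i \<in> {..<N}"
    have "k < N \<and> l k < N" if "i \<in> block k" for k
      using that i k_less[of k] by (auto simp: block_def)
    moreover have "i \<in> free \<or> i \<le> p \<or> i mod p = p - 2 \<or> i mod p = p - 1 \<or> (\<exists>k. i \<in> block k)"
      unfolding free_def using not_less by blast
    ultimately show "i \<in> (free \<inter> {..<N}) \<union> {..p} \<union> ?R (p - 2) \<union> ?R (p - 1) \<union> ?B"
      using i by blast
  qed
  then have "N \<le> card ((free \<inter> {..<N}) \<union> {..p} \<union> ?R (p - 2) \<union> ?R (p - 1) \<union> ?B)"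
    using card_mono[of "(free \<inter> {..<N}) \<union> {..p} \<union> ?R (p - 2) \<union> ?R (p - 1) \<union> ?B" "{..<N}"]
    by (simp add: block_def)
  also have "\<dots> \<le> card (free \<inter> {..<N}) + card {..p} + card (?R (p - 2)) + card (?R (p - 1)) + card ?B"
    by (intro order_trans[OF card_Un_le] add_mono order_refl)
  finally have count: "real N \<le> real (card (free \<inter> {..<N})) + (real p + 1)
      + real (card (?R (p - 2))) + real (card (?R (p - 1))) + real (card ?B)"
    by (simp flip: of_nat_add of_nat_Suc)
  have res: "real (card (?R r)) \<le> real N / real p + 1" for r
  proof -
    have "real (card (?R r)) \<le> real (N div p) + 1" using card_residue_le[of N r] by linarith
    then show ?thesis using of_nat_div_le_of_nat[of N p, where ?'a = real] by linarith
  qed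
  have "real (card ?B) \<le> (\<Sum>k\<in>{k. k < N \<and> l k < N}. real (card (block k)))"
    using card_UN_le[of "{k. k < N \<and> l k < N}" block] by (simp flip: of_nat_sum)
  also have "\<dots> \<le> (\<Sum>k\<in>{k. k < N \<and> l k < N}. real N / real p * (1 / 2) ^ Suc k)"
  proof (rule sum_mono)
    fix k assume "k \<in> {k. k < N \<and> l k < N}"
    then have "p * 2 ^ Suc k * card (block k) \<le> N" using sparse[of k] by (simp add: block_def add.assoc)
    then have "real p * 2 ^ Suc k * real (card (block k)) \<le> real N"
      by (metis (mono_tags, lifting) of_nat_le_iff of_nat_mult of_nat_numeral of_nat_power)
    then show "real (card (block k)) \<le> real N / real p * (1 / 2) ^ Suc k"
      using p_ge_3 by (simp add: field_simps power_divide)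
  qed
  also have "\<dots> \<le> (\<Sum>k. real N / real p * (1 / 2) ^ Suc k)"
    using sums_mult[OF power_half_series, of "real N / real p"]
    by (intro sum_le_suminf) (auto simp: sums_iff)
  also have "\<dots> = real N / real p"
    using sums_mult[OF power_half_series, of "real N / real p"] by (simp add: sums_iff)
  finally have "real (card ?B) \<le> real N / real p" .
  moreover have "(1 - 3 / real p) * real N = real N - 3 * (real N / real p)"
    by (simp add: algebra_simps)
  ultimately show ?thesis using count res[of "p - 2"] res[of "p - 1"] by linarith
qed

end

section \<open>Exponents realizing prescribed growth rates\<close>

lemma LIMSEQ_ceiling_ratio:
  fixes x a :: "nat \<Rightarrow> real" and d :: nat
  assumes a: "\<And>k. a k > 0" and small: "(\<lambda>k. real (k + d) / a k) \<longlonglongrightarrow> 0"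
    and A: "A \<ge> 0"
  shows "(\<lambda>k. real (nat \<lceil>A * a k\<rceil> + k + d) / a k) \<longlonglongrightarrow> A"
proof (rule tendsto_sandwich)
  have c: "real (nat \<lceil>A * a k\<rceil>) = of_int \<lceil>A * a k\<rceil>" for k
    using A a[of k] by simp
  show "eventually (\<lambda>k. A \<le> real (nat \<lceil>A * a k\<rceil> + k + d) / a k) sequentially"
  proof (intro always_eventually allI)
    fix k
    have "A * a k \<le> real (nat \<lceil>A * a k\<rceil> + k + d)" using le_of_int_ceiling[of "A * a k"] c[of k] by linarith
    then show "A \<le> real (nat \<lceil>A * a k\<rceil> + k + d) / a k" using a[of k] by (simp add: le_divide_eq)
  qed
  show "eventually (\<lambda>k. real (nat \<lceil>A * a k\<rceil> + k + d) / a k \<le> A + real (Suc k + d) / a k) sequentially"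
  proof (intro always_eventually allI)
    fix k
    have "real (nat \<lceil>A * a k\<rceil> + k + d) \<le> A * a k + real (Suc k + d)"
      using ceiling_correct[of "A * a k"] c[of k] by simp
    then have "real (nat \<lceil>A * a k\<rceil> + k + d) / a k \<le> (A * a k + real (Suc k + d)) / a k"
      using a[of k] by (intro divide_right_mono) auto
    then show "real (nat \<lceil>A * a k\<rceil> + k + d) / a k \<le> A + real (Suc k + d) / a k"
      using a[of k] by (simp only: add_divide_distrib) simp
  qed
  have "(\<lambda>k. real (Suc k + d) / a k) \<longlonglongrightarrow> 0"
  proof (rule Lim_null_comparison)
    show "eventually (\<lambda>k. norm (real (Suc k + d) / a k) \<le> 2 * (real (k + d) / a k)) sequentially"
      using eventually_ge_at_top[of 1]
    proof eventually_elim
      case (elim k)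
      have "real (Suc k + d) \<le> 2 * real (k + d)" using elim by simp
      then show ?case using a[of k] by (simp add: divide_right_mono)
    qed
    show "(\<lambda>k. 2 * (real (k + d) / a k)) \<longlonglongrightarrow> 0"
      using tendsto_mult[OF tendsto_const[of 2] small] by simp
  qed
  then show "(\<lambda>k. A + real (Suc k + d) / a k) \<longlonglongrightarrow> A"
    using tendsto_add[OF tendsto_const[of A]] by fastforce
qed simp

text \<open>
  The choice \<open>b k = \<lceil>A k * a k\<rceil> + k + d\<close> makes \<open>b k / a k\<close> follow \<open>A k\<close>, while the summand \<open>k\<close> provides the
  gap between \<open>a k\<close> and \<open>b k\<close> that sparsity of the copies requires even when \<open>A k = 1\<close>.
\<close>
lemma strict_mono_ceiling_mult:
  fixes a :: "nat \<Rightarrow> nat" and A :: "nat \<Rightarrow> real" and d :: nat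
  assumes "strict_mono a" "mono A" "\<And>k. A k \<ge> 1"
  shows "strict_mono (\<lambda>k. nat \<lceil>A k * real (a k)\<rceil> + k + d)"
    and "a k + k + d \<le> nat \<lceil>A k * real (a k)\<rceil> + k + d"
proof -
  have "A k * real (a k) \<le> A (Suc k) * real (a (Suc k))" for k
    using assms by (intro mult_mono monoD[OF assms(2)])
      (auto simp: strict_mono_less_eq intro: order_trans[OF zero_le_one])
  then show "strict_mono (\<lambda>k. nat \<lceil>A k * real (a k)\<rceil> + k + d)"
    unfolding strict_mono_Suc_iff by (auto intro!: add_le_less_mono le_imp_less_Suc nat_mono ceiling_mono)
  have "real (a k) \<le> A k * real (a k)" using mult_right_mono[OF assms(3)[of k], of "real (a k)"] by simp
  then have "int (a k) \<le> \<lceil>A k * real (a k)\<rceil>" by (simp add: le_ceiling_iff)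
  then show "a k + k + d \<le> nat \<lceil>A k * real (a k)\<rceil> + k + d" by simp
qed

text \<open>
  Rounding \<open>(k + d + 1)\<^sup>2 \<theta>\<^sup>k\<close> covers \<open>\<theta> = 1\<close> and \<open>\<theta> > 1\<close> at once: the quadratic factor does not affect the
  limit ratio, but it guarantees strict growth and outgrows \<open>k\<close>.
\<close>
lemma ratio_limits_geometric:
  fixes \<theta> :: real and d :: nat
  assumes "\<theta> \<ge> 1"
  obtains a :: "nat \<Rightarrow> nat" where "strict_mono a" "\<And>k. k + d \<le> a k" "\<And>k. 0 < a k"
    "(\<lambda>k. real (k + d) / real (a k)) \<longlonglongrightarrow> 0"
    "(\<lambda>k. real (a (Suc k)) / real (a k)) \<longlonglongrightarrow> \<theta>"
proof -
  define u where "u k = real (k + d + 1) ^ 2 * \<theta> ^ k" for k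
  define a where "a k = nat \<lceil>u k\<rceil>" for k
  have u_ge: "u k \<ge> real (k + d + 1) ^ 2" for k
    using mult_left_mono[OF one_le_power[OF assms, of k], of "real (k + d + 1) ^ 2"] by (simp add: u_def)
  have u_ge': "u k \<ge> real (k + d + 1)" for k
    using u_ge[of k] self_le_power[of "real (k + d + 1)" 2] by simp
  then have u_pos: "u k > 0" for k using less_le_trans[OF _ u_ge'[of k], of 0] by simp
  have a_ge: "u k \<le> real (a k)" and a_le: "real (a k) \<le> u k + 1" for k
    using u_pos[of k] ceiling_correct[of "u k"] by (auto simp: a_def)
  have a_pos: "real (a k) > 0" for k using a_ge[of k] u_pos[of k] by linarith
  have "u k + 1 < u (Suc k)" for k
  proof -
    have "real (k + d + 1) ^ 2 * \<theta> ^ k + 1 * \<theta> ^ k < real (Suc k + d + 1) ^ 2 * \<theta> ^ k"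
      using assms by (auto simp: power2_eq_square algebra_simps intro!: add_pos_nonneg)
    also have "\<dots> \<le> u (Suc k)"
      unfolding u_def using assms by (intro mult_left_mono power_increasing) auto
    finally show ?thesis using one_le_power[OF assms, of k] by (simp add: u_def)
  qed
  then have "real (a k) < real (a (Suc k))" for k
    using a_le[of k] a_ge[of "Suc k"] by (meson le_less_trans less_le_trans)
  then have mono: "strict_mono a" by (simp add: strict_mono_Suc_iff)
  have ge: "k + d \<le> a k" for k using u_ge'[of k] a_ge[of k] by linarith
  have small: "(\<lambda>k. real (k + d) / real (a k)) \<longlonglongrightarrow> 0"
  proof (rule Lim_null_comparison)
    show "eventually (\<lambda>k. norm (real (k + d) / real (a k)) \<le> 1 / real (k + d + 1)) sequentially"
    proof (intro always_eventually allI)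
      fix k
      have "real (k + d) * real (k + d + 1) \<le> real (k + d + 1) ^ 2" by (simp add: power2_eq_square)
      also have "\<dots> \<le> real (a k)" using u_ge[of k] a_ge[of k] by (rule order_trans)
      finally show "norm (real (k + d) / real (a k)) \<le> 1 / real (k + d + 1)"
        using a_pos[of k] by (simp add: divide_le_eq le_divide_eq)
    qed
    show "(\<lambda>k. 1 / real (k + d + 1)) \<longlonglongrightarrow> 0" by real_asymp
  qed
  have au: "(\<lambda>k. real (a k) / u k) \<longlonglongrightarrow> 1"
  proof (rule tendsto_sandwich[of "\<lambda>_. 1" _ _ "\<lambda>k. 1 + 1 / real (k + d + 1)"])
    show "eventually (\<lambda>k. 1 \<le> real (a k) / u k) sequentially"
      using a_ge u_pos by (simp add: le_divide_eq)
    show "eventually (\<lambda>k. real (a k) / u k \<le> 1 + 1 / real (k + d + 1)) sequentially"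
    proof (intro always_eventually allI)
      fix k
      have "real (a k) / u k \<le> 1 + 1 / u k"
        using a_le[of k] u_pos[of k] by (simp add: field_simps)
      also have "1 / u k \<le> 1 / real (k + d + 1)" using u_ge'[of k] by (intro divide_left_mono) (auto simp: u_pos)
      finally show "real (a k) / u k \<le> 1 + 1 / real (k + d + 1)" by simp
    qed
    show "(\<lambda>k. 1 + 1 / real (k + d + 1)) \<longlonglongrightarrow> 1" by real_asymp
  qed simp
  have "(\<lambda>k. (real (Suc k + d + 1) / real (k + d + 1)) ^ 2 * \<theta>) \<longlonglongrightarrow> \<theta>"
    using assms by real_asymp
  moreover have "(real (Suc k + d + 1) / real (k + d + 1)) ^ 2 * \<theta> = u (Suc k) / u k" for k
    using assms by (simp add: u_def power_divide)
  ultimately have "(\<lambda>k. u (Suc k) / u k) \<longlonglongrightarrow> \<theta>" by simp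
  then have "(\<lambda>k. (real (a (Suc k)) / u (Suc k)) * (u (Suc k) / u k) / (real (a k) / u k)) \<longlonglongrightarrow> 1 * \<theta> / 1"
    by (intro tendsto_intros LIMSEQ_Suc[OF au] au) simp_all
  moreover have "(real (a (Suc k)) / u (Suc k)) * (u (Suc k) / u k) / (real (a k) / u k)
      = real (a (Suc k)) / real (a k)" for k
    using u_pos[of k] u_pos[of "Suc k"] a_pos[of k] by (simp add: field_simps)
  ultimately have "(\<lambda>k. real (a (Suc k)) / real (a k)) \<longlonglongrightarrow> \<theta>" by (simp only: mult_1 div_by_1)
  with mono ge small a_pos show ?thesis by (intro that) auto
qed

text \<open>
  Since \<open>b (k+1) / a k\<close> is about \<open>\<alpha> * a (k+1) / a k\<close>, the ratios of consecutive \<open>a k\<close> have to tend to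
  \<open>\<beta> / \<alpha>\<close>. For \<open>\<beta> = \<infinity>\<close> and finite \<open>\<alpha>\<close> factorials do this; for \<open>\<alpha> = \<infinity>\<close> linear growth of \<open>a\<close>
  suffices, with the factor \<open>1 + k\<close> in place of \<open>\<alpha>\<close>.
\<close>
lemma exists_exponents:
  fixes \<alpha> \<beta> :: ereal and d :: nat
  assumes "1 \<le> \<alpha>" "\<alpha> \<le> \<beta>" "d > 0"
  obtains a b :: "nat \<Rightarrow> nat" where "strict_mono a" "strict_mono b"
    "\<And>k. k + d \<le> a k" "\<And>k. a k + k + d \<le> b k"
    "(\<lambda>k. ereal (real (b k) / real (a k))) \<longlonglongrightarrow> \<alpha>"
    "(\<lambda>k. ereal (real (b (Suc k)) / real (a k))) \<longlonglongrightarrow> \<beta>"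
proof -
  consider (inf) "\<alpha> = \<infinity>" "\<beta> = \<infinity>" | (mix) A where "\<alpha> = ereal A" "A \<ge> 1" "\<beta> = \<infinity>"
    | (fin) A B where "\<alpha> = ereal A" "A \<ge> 1" "\<beta> = ereal B" "A \<le> B"
    using assms by (cases \<alpha>; cases \<beta>) auto
  then show ?thesis
  proof cases
    case inf
    define a b where "a k = k + d" and "b k = nat \<lceil>(1 + real k) * real (a k)\<rceil> + k + d" for k
    have a: "strict_mono a" by (simp add: a_def strict_mono_Suc_iff)
    have A: "mono (\<lambda>k. 1 + real k)" by (simp add: mono_def)
    note b = strict_mono_ceiling_mult[OF a, of "\<lambda>k. 1 + real k", where d = d, folded b_def, OF A]
    have lim: "LIM k sequentially. real (b k) / real (a k) :> at_top"
    proof (rule filterlim_at_top_mono)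
      show "LIM k sequentially. 1 + real k :> at_top" by real_asymp
      show "eventually (\<lambda>k. 1 + real k \<le> real (b k) / real (a k)) sequentially"
      proof (intro always_eventually allI)
        fix k
        have "(1 + real k) * real (a k) \<le> real (b k)"
          unfolding b_def using real_nat_ceiling_ge[of "(1 + real k) * real (a k)"] by simp
        then show "1 + real k \<le> real (b k) / real (a k)"
          using assms(3) by (simp add: a_def le_divide_eq)
      qed
    qed
    have lim2: "LIM k sequentially. real (b (Suc k)) / real (a k) :> at_top"
    proof (rule filterlim_at_top_mono[OF lim])
      show "eventually (\<lambda>k. real (b k) / real (a k) \<le> real (b (Suc k)) / real (a k)) sequentially"
        using strict_mono_less_eq[OF b(1)] by (intro always_eventually allI divide_right_mono) auto
    qed
    show ?thesis
    proof (rule that[of a b])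
      show "a k + k + d \<le> b k" for k using b(2)[of k] by simp
    qed (use inf a b(1) lim lim2 in \<open>auto simp: a_def tendsto_PInfty_eq_at_top\<close>)
  next
    case mix
    define a :: "nat \<Rightarrow> nat" where "a k = fact (k + d + 2)" for k
    define b where "b k = nat \<lceil>A * real (a k)\<rceil> + k + d" for k
    have step: "a (Suc k) = (k + d + 3) * a k" for k by (simp add: a_def numeral_3_eq_3)
    have a_pos: "a k > 0" for k by (simp add: a_def)
    have a: "strict_mono a" using a_pos by (simp add: strict_mono_Suc_iff step)
    note b = strict_mono_ceiling_mult[OF a, of "\<lambda>_. A", where d = d, folded b_def]
    have quad: "(k + d) * (k + d + 1) \<le> a k" for k
    proof -
      have "(k + d + 1) * 1 \<le> (k + d + 1) * fact (k + d)" by (intro mult_left_mono fact_ge_1) simp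
      then have "(k + d) * (k + d + 1) \<le> (k + d + 2) * fact (k + d + 1)"
        by (intro mult_mono) (simp_all del: fact_Suc add: fact_Suc[of "k + d", simplified])
      then show ?thesis by (simp add: a_def)
    qed
    have a_ge: "k + d \<le> a k" for k using quad[of k] by (simp add: algebra_simps)
    have small: "(\<lambda>k. real (k + d) / real (a k)) \<longlonglongrightarrow> 0"
    proof (rule Lim_null_comparison)
      show "eventually (\<lambda>k. norm (real (k + d) / real (a k)) \<le> 1 / real (k + d + 1)) sequentially"
      proof (intro always_eventually allI)
        fix k
        have "real (k + d) * real (k + d + 1) \<le> real (a k)"
          using quad[of k] by (metis of_nat_le_iff of_nat_mult)
        then show "norm (real (k + d) / real (a k)) \<le> 1 / real (k + d + 1)"
          using a_pos[of k] by (simp add: divide_le_eq le_divide_eq)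
      qed
      show "(\<lambda>k. 1 / real (k + d + 1)) \<longlonglongrightarrow> 0" by real_asymp
    qed
    have lim: "(\<lambda>k. real (b k) / real (a k)) \<longlonglongrightarrow> A"
      unfolding b_def using LIMSEQ_ceiling_ratio[of "\<lambda>k. real (a k)" d A] a_pos small mix by simp
    have lim2: "LIM k sequentially. real (b (Suc k)) / real (a k) :> at_top"
    proof (rule filterlim_at_top_mono)
      show "LIM k sequentially. real k :> at_top" by real_asymp
      show "eventually (\<lambda>k. real k \<le> real (b (Suc k)) / real (a k)) sequentially"
      proof (intro always_eventually allI)
        fix k
        have "k * a k \<le> a (Suc k)" by (simp add: step)
        also have "\<dots> \<le> b (Suc k)" using b(2)[of "Suc k"] mix by simp
        finally have "real k * real (a k) \<le> real (b (Suc k))" by (metis of_nat_le_iff of_nat_mult)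
        then show "real k \<le> real (b (Suc k)) / real (a k)" using a_pos[of k] by (simp add: le_divide_eq)
      qed
    qed
    show ?thesis
    proof (rule that[of a b])
      show "a k + k + d \<le> b k" for k using b(2)[of k] mix by (simp add: mono_def)
    qed (use mix a b(1) a_ge lim lim2 in \<open>auto simp: tendsto_PInfty_eq_at_top mono_def\<close>)
  next
    case fin
    then have "B / A \<ge> 1" by (simp add: le_divide_eq)
    then obtain a :: "nat \<Rightarrow> nat" where a: "strict_mono a" "\<And>k. k + d \<le> a k" "\<And>k. 0 < a k"
      "(\<lambda>k. real (k + d) / real (a k)) \<longlonglongrightarrow> 0"
      "(\<lambda>k. real (a (Suc k)) / real (a k)) \<longlonglongrightarrow> B / A"
      using ratio_limits_geometric[of "B / A" d] by blast
    define b where "b k = nat \<lceil>A * real (a k)\<rceil> + k + d" for k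
    note b = strict_mono_ceiling_mult[OF a(1), of "\<lambda>_. A", where d = d, folded b_def]
    have lim: "(\<lambda>k. real (b k) / real (a k)) \<longlonglongrightarrow> A"
      unfolding b_def using LIMSEQ_ceiling_ratio[of "\<lambda>k. real (a k)" d A] a fin by simp
    have "(\<lambda>k. real (b (Suc k)) / real (a (Suc k)) * (real (a (Suc k)) / real (a k))) \<longlonglongrightarrow> A * (B / A)"
      by (intro tendsto_mult LIMSEQ_Suc[OF lim] a)
    moreover have "real (b (Suc k)) / real (a (Suc k)) * (real (a (Suc k)) / real (a k))
        = real (b (Suc k)) / real (a k)" for k
      using a(3)[of "Suc k"] by simp
    moreover have "A * (B / A) = B" using fin by simp
    ultimately have lim2: "(\<lambda>k. real (b (Suc k)) / real (a k)) \<longlonglongrightarrow> B" by (simp only:)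
    show ?thesis
    proof (rule that[of a b])
      show "a k + k + d \<le> b k" for k using b(2)[of k] fin by (simp add: mono_def)
    qed (use fin a b(1) lim lim2 in \<open>auto simp: mono_def\<close>)
  qed
qed

lemma tendsto_ereal_shift_denominator:
  fixes a b :: "nat \<Rightarrow> nat" and c :: nat
  assumes lim: "(\<lambda>k. ereal (real (b k) / real (a k))) \<longlonglongrightarrow> L" and "L > 0"
    and a: "strict_mono a" "\<And>k. 0 < a k"
  shows "(\<lambda>k. ereal (real (b k) / real (a k + c))) \<longlonglongrightarrow> L"
proof -
  have "filterlim (\<lambda>k. real (a k)) at_top sequentially"
    using filterlim_compose[OF filterlim_real_sequentially filterlim_subseq[OF a(1)]] .
  moreover have "((\<lambda>x. x / (x + real c)) \<longlongrightarrow> 1) at_top" by real_asymp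
  ultimately have "(\<lambda>k. real (a k) / (real (a k) + real c)) \<longlonglongrightarrow> 1"
    by (rule filterlim_compose[rotated])
  then have "(\<lambda>k. ereal (real (b k) / real (a k)) * ereal (real (a k) / (real (a k) + real c))) \<longlonglongrightarrow> L * ereal 1"
    using \<open>L > 0\<close> by (intro tendsto_mult_ereal_pos lim) auto
  moreover have "ereal (real (b k) / real (a k)) * ereal (real (a k) / (real (a k) + real c))
      = ereal (real (b k) / real (a k + c))" for k
    using a(2)[of k] by simp
  ultimately show ?thesis by (simp only: mult_1_right flip: one_ereal_def)
qed

section \<open>Return rates along a dyadic scale\<close>

lemma return_rate_ge:
  assumes "enat (2 ^ b) \<le> return_time n x" "n > 1"
  shows "ereal (real b * ln 2 / ln (real n)) \<le> return_rate x n"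
proof -
  have "ereal (ln (real (2 ^ b))) \<le> ln_enat (return_time n x)"
  proof (cases "return_time n x")
    case (enat r)
    with assms(1) have "real (2 ^ b) \<le> real r" by simp
    then have "ln (real (2 ^ b)) \<le> ln (real r)" by (subst ln_le_cancel_iff) (auto intro: less_le_trans[rotated])
    then show ?thesis using enat by (simp add: ln_enat_def)
  qed (simp add: ln_enat_def)
  then have "ereal (ln (real (2 ^ b))) / ereal (ln (real n)) \<le> return_rate x n"
    unfolding return_rate_def using assms(2) by (intro ereal_divide_right_mono) auto
  then show ?thesis using assms(2) by (simp add: ln_realpow)
qed

lemma return_rate_le:
  assumes "return_time n x \<le> enat (2 ^ b)" "n > 1"
  shows "return_rate x n \<le> ereal (real b * ln 2 / ln (real n))"
proof -
  obtain r where r: "return_time n x = enat r" "r \<le> 2 ^ b"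
    using assms(1) by (cases "return_time n x") auto
  have "ln (real r) \<le> ln (real (2 ^ b))"
  proof (cases "r = 0")
    case False
    then show ?thesis using r(2) by (subst ln_le_cancel_iff) (auto simp flip: of_nat_power)
  qed simp
  then have "ln_enat (return_time n x) \<le> ereal (ln (real (2 ^ b)))"
    using r by (simp add: ln_enat_def)
  then have "return_rate x n \<le> ereal (ln (real (2 ^ b))) / ereal (ln (real n))"
    unfolding return_rate_def using assms(2) by (intro ereal_divide_right_mono) auto
  then show ?thesis using assms(2) by (simp add: ln_realpow)
qed

lemma log_ratio_ge:
  assumes "1 < n" "n \<le> 2 ^ e"
  shows "real b / real e \<le> real b * ln 2 / ln (real n)"
proof -
  have "real n \<le> 2 ^ e" using of_nat_mono[OF assms(2), where ?'a = real] by simp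
  then have "ln (real n) \<le> ln (2 ^ e)" using assms(1) by (subst ln_le_cancel_iff) auto
  then have *: "ln (real n) \<le> real e * ln 2" by (simp add: ln_realpow)
  have "0 < ln (real n)" using assms by simp
  then have "real b * ln 2 / (real e * ln 2) \<le> real b * ln 2 / ln (real n)"
    using * by (intro divide_left_mono) auto
  then show ?thesis by simp
qed

lemma log_ratio_le:
  assumes "1 < n" "2 ^ e \<le> n" "0 < e"
  shows "real b * ln 2 / ln (real n) \<le> real b / real e"
proof -
  have "2 ^ e \<le> real n" using of_nat_mono[OF assms(2), where ?'a = real] by simp
  then have "ln (2 ^ e) \<le> ln (real n)" using assms(1) by (subst ln_le_cancel_iff) auto
  then have *: "real e * ln 2 \<le> ln (real n)" by (simp add: ln_realpow)
  have "real b * ln 2 / ln (real n) \<le> real b * ln 2 / (real e * ln 2)"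
    using * assms by (intro divide_left_mono) auto
  then show ?thesis by simp
qed

text \<open>
  For \<open>n\<close> between \<open>2 ^ a (k-1)\<close> and \<open>2 ^ a k\<close> the return time is \<open>2 ^ b k\<close>, up to a factor 2 in \<open>n\<close>. The
  rate therefore lies between \<open>b k / a k\<close>, at the right end, and \<open>b k / a (k-1)\<close>, at the left end, up to
  bounded changes of the denominators, which do not affect the limits.
\<close>
lemma return_rate_limits:
  fixes a b :: "nat \<Rightarrow> nat"
  assumes a: "strict_mono a" "\<And>k. 0 < a k"
    and upper: "\<And>n k. n \<le> 2 ^ a k \<Longrightarrow> return_time n x \<le> enat (2 ^ b k)"
    and lower: "\<And>n k. n0 < n \<Longrightarrow> (\<And>j. j < k \<Longrightarrow> 2 ^ (a j + 1) < n) \<Longrightarrow> enat (2 ^ b k) \<le> return_time n x"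
    and lim: "(\<lambda>k. ereal (real (b k) / real (a k))) \<longlonglongrightarrow> \<alpha>"
      "(\<lambda>k. ereal (real (b (Suc k)) / real (a k))) \<longlonglongrightarrow> \<beta>"
    and pos: "0 < \<alpha>" "\<alpha> \<le> \<beta>"
  shows "liminf (return_rate x) = \<alpha>" "limsup (return_rate x) = \<beta>"
proof -
  have k_le: "k \<le> a k" for k using strict_mono_imp_increasing[OF a(1)] .
  have "\<alpha> \<le> liminf (return_rate x)"
    unfolding le_Liminf_iff
  proof (intro allI impI)
    fix y assume "y < \<alpha>"
    have "eventually (\<lambda>k. y < ereal (real (b k) / real (a k + 1))) sequentially"
      using tendsto_ereal_shift_denominator[OF lim(1) pos(1) a] \<open>y < \<alpha>\<close> by (rule order_tendstoD)
    then obtain K where K: "\<And>k. k \<ge> K \<Longrightarrow> y < ereal (real (b k) / real (a k + 1))"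
      by (auto simp: eventually_sequentially)
    show "eventually (\<lambda>n. y < return_rate x n) sequentially"
      using eventually_gt_at_top[of "max n0 (2 ^ (a K + 1))"]
    proof eventually_elim
      case (elim n)
      then have n: "n0 < n" "2 ^ (a K + 1) < n" by auto
      then have "1 < n" using one_le_power[of "2::nat" "a K + 1"] by linarith
      define k where "k = (LEAST k. n \<le> 2 ^ (a k + 1))"
      have "n \<le> 2 ^ (a n + 1)"
        using k_le[of n] less_exp[of "a n + 1"] by linarith
      then have k: "n \<le> 2 ^ (a k + 1)" unfolding k_def by (rule LeastI)
      have less: "2 ^ (a j + 1) < n" if "j < k" for j
        using not_less_Least[of j "\<lambda>k. n \<le> 2 ^ (a k + 1)"] that unfolding k_def by simp
      have "(2::nat) ^ (a K + 1) < 2 ^ (a k + 1)" using n(2) k by linarith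
      then have "K \<le> k" using strict_mono_less[OF a(1)] by simp
      then have "y < ereal (real (b k) / real (a k + 1))" by (rule K)
      also have "\<dots> \<le> ereal (real (b k) * ln 2 / ln (real n))"
        using log_ratio_ge[OF \<open>1 < n\<close> k, of "b k"] by simp
      also have "\<dots> \<le> return_rate x n"
        using lower[OF n(1) less] \<open>1 < n\<close> by (rule return_rate_ge)
      finally show ?case .
    qed
  qed
  moreover have "limsup (return_rate x) \<le> \<beta>"
    unfolding Limsup_le_iff
  proof (intro allI impI)
    fix y assume "y > \<beta>"
    with lim(2) have "eventually (\<lambda>k. ereal (real (b (Suc k)) / real (a k)) < y) sequentially"
      by (rule order_tendstoD)
    then obtain K where K: "\<And>k. k \<ge> K \<Longrightarrow> ereal (real (b (Suc k)) / real (a k)) < y"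
      by (auto simp: eventually_sequentially)
    show "eventually (\<lambda>n. return_rate x n < y) sequentially"
      using eventually_gt_at_top[of "2 ^ a K"]
    proof eventually_elim
      case (elim n)
      then have "1 < n" using one_le_power[of "2::nat" "a K"] by linarith
      define k where "k = (LEAST k. n \<le> 2 ^ a k)"
      have "n \<le> 2 ^ a n" using k_le[of n] less_exp[of "a n"] by linarith
      then have k: "n \<le> 2 ^ a k" unfolding k_def by (rule LeastI)
      have "(2::nat) ^ a K < 2 ^ a k" using elim k by linarith
      then have "K < k" using strict_mono_less[OF a(1)] by simp
      then obtain j where j: "k = Suc j" "K \<le> j" by (cases k) auto
      have n: "2 ^ a j \<le> n"
        using not_less_Least[of j "\<lambda>k. n \<le> 2 ^ a k"] j(1) unfolding k_def by simp
      have "return_rate x n \<le> ereal (real (b k) * ln 2 / ln (real n))"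
        using upper[OF k] \<open>1 < n\<close> by (rule return_rate_le)
      also have "\<dots> \<le> ereal (real (b (Suc j)) / real (a j))"
        unfolding j(1) using log_ratio_le[OF \<open>1 < n\<close> n a(2)] by simp
      also have "\<dots> < y" using j(2) by (rule K)
      finally show ?case .
    qed
  qed
  moreover have "liminf (return_rate x) \<le> \<alpha>"
  proof -
    have "strict_mono (\<lambda>k. 2 ^ a k :: nat)" using a(1) by (auto simp: strict_mono_def)
    then have "liminf (return_rate x) \<le> liminf (return_rate x \<circ> (\<lambda>k. 2 ^ a k))"
      by (rule liminf_subseq_mono)
    also have "\<dots> \<le> liminf (\<lambda>k. ereal (real (b k) / real (a k)))"
    proof (intro Liminf_mono always_eventually allI)
      fix k
      have gt: "1 < (2::nat) ^ a k" by (rule one_less_power) (use a(2)[of k] in auto)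
      have "return_rate x (2 ^ a k) \<le> ereal (real (b k) * ln 2 / ln (real (2 ^ a k)))"
        using upper[OF order_refl] gt by (rule return_rate_le)
      also have "\<dots> \<le> ereal (real (b k) / real (a k))"
        using log_ratio_le[OF gt order_refl a(2)] by simp
      finally show "(return_rate x \<circ> (\<lambda>k. 2 ^ a k)) k \<le> ereal (real (b k) / real (a k))" by simp
    qed
    also have "\<dots> = \<alpha>" using lim(1) by (intro lim_imp_Liminf) auto
    finally show ?thesis .
  qed
  moreover have "\<beta> \<le> limsup (return_rate x)"
  proof -
    have "\<beta> = limsup (\<lambda>k. ereal (real (b (Suc k)) / real (a k + 2)))"
    proof (rule lim_imp_Limsup[symmetric])
      have "\<beta> > 0" using pos by simp
      then show "(\<lambda>k. ereal (real (b (Suc k)) / real (a k + 2))) \<longlonglongrightarrow> \<beta>"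
        using tendsto_ereal_shift_denominator[of "\<lambda>k. b (Suc k)", OF lim(2) _ a, where c = 2] by blast
    qed simp
    also have "\<dots> \<le> limsup (return_rate x \<circ> (\<lambda>k. 2 ^ (a k + 2)))"
    proof (rule Limsup_mono)
      show "eventually (\<lambda>k. ereal (real (b (Suc k)) / real (a k + 2))
          \<le> (return_rate x \<circ> (\<lambda>k. 2 ^ (a k + 2))) k) sequentially"
        using eventually_ge_at_top[of n0]
      proof eventually_elim
        case (elim k)
        have gt: "1 < (2::nat) ^ (a k + 2)" by (rule one_less_power) auto
        have n0: "n0 < 2 ^ (a k + 2)" using elim k_le[of k] less_exp[of "a k + 2"] by linarith
        have "2 ^ (a j + 1) < (2::nat) ^ (a k + 2)" if "j < Suc k" for j
          using that strict_mono_less_eq[OF a(1), of j k] by (intro power_strict_increasing) auto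
        then have "enat (2 ^ b (Suc k)) \<le> return_time (2 ^ (a k + 2)) x" by (rule lower[OF n0])
        then have "ereal (real (b (Suc k)) * ln 2 / ln (real (2 ^ (a k + 2)))) \<le> return_rate x (2 ^ (a k + 2))"
          using gt by (rule return_rate_ge)
        moreover have "ereal (real (b (Suc k)) / real (a k + 2))
            \<le> ereal (real (b (Suc k)) * ln 2 / ln (real (2 ^ (a k + 2))))"
          using log_ratio_ge[OF gt order_refl] by (simp only: ereal_less_eq)
        ultimately show ?case unfolding comp_def by (rule order_trans[rotated])
      qed
    qed
    also have "\<dots> \<le> limsup (return_rate x)"
      by (rule limsup_subseq_mono) (use a(1) in \<open>auto simp: strict_mono_def\<close>)
    finally show ?thesis .
  qed
  ultimately show "liminf (return_rate x) = \<alpha>" "limsup (return_rate x) = \<beta>"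
    by (auto intro: antisym)
qed

section \<open>The dimension of the level sets\<close>

text \<open>
  The margin \<open>k + (q + 2)\<close> in \<open>a\<close> bounds the length of the marker by \<open>2 ^ a k\<close>, so that a block is at most
  twice as long as its copy; the same margin in \<open>b\<close> pays for this factor 2 and for the factor
  \<open>p * 2 ^ Suc k\<close> of the sparsity condition, with \<open>p = 2 ^ q\<close>.
\<close>
lemma prefix_insertion_powers:
  fixes a b :: "nat \<Rightarrow> nat"
  assumes "q \<ge> 2" "strict_mono b" and a: "\<And>k. k + (q + 2) \<le> a k" and b: "\<And>k. a k + k + (q + 2) \<le> b k"
  shows "prefix_insertion (2 ^ q) (\<lambda>k. 2 ^ a k) (\<lambda>k. 2 ^ b k)"
    and "2 ^ a k + k + 2 ^ q + 4 \<le> (2::nat) ^ (a k + 1)"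
proof -
  have q: "(4::nat) \<le> 2 ^ q" using power_increasing[OF assms(1), of "2::nat"] by simp
  have pad: "2 ^ a k + k + 2 ^ q + 4 \<le> (2::nat) ^ (a k + 1)" for k
  proof -
    have "k + 2 ^ q + 4 \<le> (k + 1) * (2 ^ q * 4)"
    proof -
      have "k * 1 \<le> k * (2 ^ q * 4)" using q by (intro mult_left_mono) auto
      then show ?thesis using q unfolding add_mult_distrib by linarith
    qed
    also have "\<dots> \<le> 2 ^ k * (2 ^ q * 4)"
    proof (rule mult_right_mono)
      show "k + 1 \<le> 2 ^ k" using less_exp[of k] by linarith
    qed simp
    also have "\<dots> = 2 ^ (k + (q + 2))" by (simp add: power_add)
    also have "\<dots> \<le> 2 ^ a k" using a[of k] by (intro power_increasing) auto
    finally show ?thesis by simp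
  qed
  show "2 ^ a k + k + 2 ^ q + 4 \<le> (2::nat) ^ (a k + 1)" by (rule pad)
  show "prefix_insertion (2 ^ q) (\<lambda>k. 2 ^ a k) (\<lambda>k. 2 ^ b k)"
  proof
    fix k
    show "(2::nat) ^ q dvd 2 ^ b k" using b[of k] by (intro le_imp_power_dvd) simp
    have "b k + 1 \<le> b (Suc k)" using assms(2) by (simp add: strict_mono_Suc_iff Suc_le_eq)
    then have "(2::nat) ^ (b k + 1) \<le> 2 ^ b (Suc k)" by (intro power_increasing) auto
    then show "2 * 2 ^ b k \<le> (2::nat) ^ b (Suc k)" by simp
    have "2 ^ q * 2 ^ Suc k * (2 ^ a k + k + 2 ^ q + 4) \<le> 2 ^ q * 2 ^ Suc k * (2::nat) ^ (a k + 1)"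
      using pad[of k] by (intro mult_left_mono) auto
    also have "\<dots> = 2 ^ (a k + k + (q + 2))" by (simp add: power_add)
    also have "\<dots> \<le> 2 ^ b k" using b[of k] by (intro power_increasing) auto
    finally show "2 ^ q * 2 ^ Suc k * (2 ^ a k + k + 2 ^ q + 4) \<le> (2::nat) ^ b k" .
  qed (use q in auto)
qed

context shift_space
begin

lemma hausdorff_measure_return_level_set_pos:
  assumes "1 \<le> \<alpha>" "\<alpha> \<le> \<beta>" "0 \<le> s" "s < 1"
  shows "hausdorff_measure s (return_level_set m \<alpha> \<beta>) \<noteq> 0"
proof -
  have "(\<lambda>q. 1 - 3 / (2::real) ^ q) \<longlonglongrightarrow> 1" by real_asymp
  then have "eventually (\<lambda>q. s < 1 - 3 / (2::real) ^ q) sequentially"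
    using \<open>s < 1\<close> by (rule order_tendstoD)
  then have "eventually (\<lambda>q. 2 \<le> q \<and> s < 1 - 3 / (2::real) ^ q) sequentially"
    using eventually_ge_at_top[of 2] by eventually_elim simp
  then obtain q where q: "2 \<le> q" "s < 1 - 3 / (2::real) ^ q"
    by (auto simp: eventually_sequentially)
  obtain a b :: "nat \<Rightarrow> nat" where ab: "strict_mono a" "strict_mono b"
    "\<And>k. k + (q + 2) \<le> a k" "\<And>k. a k + k + (q + 2) \<le> b k"
    "(\<lambda>k. ereal (real (b k) / real (a k))) \<longlonglongrightarrow> \<alpha>"
    "(\<lambda>k. ereal (real (b (Suc k)) / real (a k))) \<longlonglongrightarrow> \<beta>"
    using exists_exponents[OF assms(1,2), of "q + 2"] by auto
  interpret prefix_insertion "2 ^ q" "\<lambda>k. 2 ^ a k" "\<lambda>k. 2 ^ b k"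
    using q(1) ab by (intro prefix_insertion_powers)
  show ?thesis
  proof (rule hausdorff_measure_free_digits_pos[where D = free and \<pi> = inserted])
    show "s * real N \<le> real (card (free \<inter> {..<N})) + (2 ^ q + 3)" for N
    proof -
      have "s * real N \<le> (1 - 3 / real (2 ^ q)) * real N"
        using q(2) by (intro mult_right_mono) auto
      also have "\<dots> \<le> real (card (free \<inter> {..<N})) + (real (2 ^ q) + 3)" by (rule card_free_ge)
      finally show ?thesis by simp
    qed
    fix \<omega> assume \<omega>: "\<omega> \<in> full_shift m"
    show "inserted \<omega> i = \<omega> i" if "i \<in> free" for i using that by (rule inserted_free)
    have a_pos: "0 < a k" for k using ab(3)[of k] by simp
    have upper: "return_time n (inserted \<omega>) \<le> enat (2 ^ b k)" if "n \<le> 2 ^ a k" for n k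
      using that by (rule return_time_inserted_le)
    have lower: "enat (2 ^ b k) \<le> return_time n (inserted \<omega>)"
      if "2 ^ q < n" "\<And>j. j < k \<Longrightarrow> 2 ^ (a j + 1) < n" for n k
    proof (rule return_time_inserted_ge[OF that(1)])
      show "2 ^ a j + j + 2 ^ q + 2 < n" if "j < k" for j
        using prefix_insertion_powers(2)[OF q(1) ab(2-4), of j] \<open>\<And>j. j < k \<Longrightarrow> 2 ^ (a j + 1) < n\<close>[OF that]
        by linarith
    qed
    have "inserted \<omega> i < m" for i
      using inserted_less[of \<omega> m] \<omega> m_ge_2 by (simp add: full_shift_def)
    moreover have "0 < \<alpha>" using assms(1) by (rule less_le_trans[rotated]) simp
    note return_rate_limits[OF ab(1) a_pos upper lower ab(5,6) this assms(2)]
    ultimately show "inserted \<omega> \<in> return_level_set m \<alpha> \<beta>"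
      by (simp add: return_level_set_def full_shift_def)
  qed fact
qed

end

theorem corollary1p2:
  fixes m :: nat and \<alpha> \<beta> :: ereal
  assumes "m \<ge> 2" and "0 \<le> \<alpha>" and "\<alpha> \<le> \<beta>"
  shows "Metric_space.hausdorff_dim (full_shift m) (shift_dist m) (return_level_set m \<alpha> \<beta>) =
           (if \<alpha> \<ge> 1 then 1 else 0)"
proof -
  interpret shift_space m by unfold_locales fact
  show ?thesis
  proof (cases "\<alpha> \<ge> 1")
    case True
    have "1 \<le> hausdorff_dim (return_level_set m \<alpha> \<beta>)"
      unfolding hausdorff_dim_def
    proof (rule INF_greatest)
      fix s :: real assume "s \<in> {s. 0 \<le> s \<and> hausdorff_measure s (return_level_set m \<alpha> \<beta>) = 0}"
      then have "1 \<le> s" using hausdorff_measure_return_level_set_pos[OF True assms(3)] not_less by blast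
      then show "1 \<le> ennreal s" by simp
    qed
    moreover have "hausdorff_dim (return_level_set m \<alpha> \<beta>) \<le> 1"
      by (rule hausdorff_dim_le_1) (auto simp: return_level_set_def)
    ultimately show ?thesis using True by simp
  next
    case False
    then show ?thesis using hausdorff_dim_return_level_set_eq_0[OF assms(2)] by simp
  qed
qed

end
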